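(* Let $\ell<k$ and $n\ge 1000k^{8}$ be positive integers. Let $\mathcal{C}$ be a family of odd cycles such that $C_{2\ell+1}$ is the shortest odd cycle not in $\mathcal{C}$ and $C_{2k+1}$ is the longest odd cycle in $\mathcal{C}$. If $G$ is an $n$-vertex $\mathcal{C}$-free graph with $$\delta(G)>\max\left\{\frac{n}{2(2\ell+1)},\ \frac{2n}{2k+3}\right\},$$ then $G$ is bipartite. Furthermore, in the case $\max\left\{\frac{n}{2(2\ell+1)},\frac{2n}{2k+3}\right\}=\frac{n}{2(2\ell+1)}$, the only $n$-vertex $\mathcal{C}$-free non-bipartite graph with minimum degree $\frac{n}{2(2\ell+1)}$ is $BC_{2\ell+1}(n)$; and in the case $\max\left\{\frac{n}{2(2\ell+1)},\frac{2n}{2k+3}\right\}=\frac{2n}{2k+3}$, the only $n$-vertex $\mathcal{C}$-free non-bipartite graph with minimum degree $\frac{2n}{2k+3}$ is $C_{2k+3}(n/(2k+3))$.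
   Context: All graphs are finite, simple and undirected; uniqueness of graphs is up to isomorphism. $\delta(G)$ is the minimum degree of $G$. $C_m$ denotes the cycle with $m$ vertices; odd cycles are $C_3,C_5,C_7,\dots$. For a family $\mathcal{C}$ of graphs, a graph is $\mathcal{C}$-free if it contains no member of $\mathcal{C}$ as a (not necessarily induced) subgraph. $BC_{2\ell+1}(n)$ denotes the $n$-vertex graph obtained by taking $2\ell+1$ vertex-disjoint copies of the complete bipartite graph $K_{n/(2(2\ell+1)),\,n/(2(2\ell+1))}$, selecting one vertex in each copy, and adding edges among the selected vertices so that they form a cycle of length $2\ell+1$ (defined when $2(2\ell+1)$ divides $n$). $C_{2k+3}(n/(2k+3))$ denotes the balanced blow-up of $C_{2k+3}$ on $n$ vertices: each vertex $v_i$ of $C_{2k+3}$ is replaced by an independent set $V_i$ of size $n/(2k+3)$, and every vertex of $V_i$ is joined to every vertex of $V_j$ exactly when $v_iv_j\in E(C_{2k+3})$ (defined when $2k+3$ divides $n$). *)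

theory Defs
  imports Complex_Main "Graph_Theory.Graph_Theory"
begin

text \<open>
  A finite simple undirected graph is a \<^locale>\<open>pair_graph\<close>: a finite, loop-free, symmetric
  digraph whose arcs are pairs of vertices. Every edge $uv$ is represented by the two arcs
  $(u,v)$ and $(v,u)$, so the degree of a vertex is its \<^const>\<open>out_degree\<close>.
\<close>

definition min_degree :: "'a pair_pre_digraph \<Rightarrow> nat" where
  "min_degree G = Min (out_degree (with_proj G) ` pverts G)"

definition bipartite :: "'a pair_pre_digraph \<Rightarrow> bool" where
  "bipartite G \<longleftrightarrow>
     (\<exists>U W. pverts G = U \<union> W \<and> U \<inter> W = {} \<and> parcs G \<subseteq> U \<times> W \<union> W \<times> U)"

definition contains_copy :: "'a pair_pre_digraph \<Rightarrow> 'b pair_pre_digraph \<Rightarrow> bool" where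
  "contains_copy G F \<longleftrightarrow> (\<exists>H. subgraph H (with_proj G) \<and> digraph_iso (with_proj F) H)"

definition family_free :: "'b pair_pre_digraph set \<Rightarrow> 'a pair_pre_digraph \<Rightarrow> bool" where
  "family_free \<C> G \<longleftrightarrow> (\<forall>F\<in>\<C>. \<not> contains_copy G F)"

text \<open>The cycle on $m$ vertices; meaningful for $m \ge 3$ only.\<close>

definition cycle_graph :: "nat \<Rightarrow> nat pair_pre_digraph" where
  "cycle_graph m =
     \<lparr> pverts = {..<m},
       parcs = {(i, j). i < m \<and> j < m \<and> (j = Suc i mod m \<or> i = Suc j mod m)} \<rparr>"

definition odd_cycles :: "nat pair_pre_digraph set" where
  "odd_cycles = {cycle_graph (2 * i + 1) |i. 1 \<le> i}"

definition blow_up :: "'a pair_pre_digraph \<Rightarrow> nat \<Rightarrow> ('a \<times> nat) pair_pre_digraph" where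
  "blow_up F t =
     \<lparr> pverts = pverts F \<times> {..<t},
       parcs = {((u, a), (v, b)) |u a v b. (u, v) \<in> parcs F \<and> a < t \<and> b < t} \<rparr>"

text \<open>Meaningful if $2k+3$ divides $n$.\<close>

definition cycle_blow_up :: "nat \<Rightarrow> nat \<Rightarrow> (nat \<times> nat) pair_pre_digraph" where
  "cycle_blow_up k n = blow_up (cycle_graph (2 * k + 3)) (n div (2 * k + 3))"

text \<open>
  $BC_{2\ell+1}(n)$, meaningful if $n$ is a positive multiple of $2(2\ell+1)$. The vertex
  $(i, s, a)$ is the $a$-th vertex on side $s$ of the $i$-th complete bipartite graph, and
  $(i, False, 0)$ is the vertex selected in that copy.
\<close>

definition BC :: "nat \<Rightarrow> nat \<Rightarrow> (nat \<times> bool \<times> nat) pair_pre_digraph" where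
  "BC l n = (let r = 2 * l + 1; m = n div (2 * r) in
     \<lparr> pverts = {..<r} \<times> UNIV \<times> {..<m},
       parcs = {((i, s, a), (i, t, b)) |i s t a b. i < r \<and> s \<noteq> t \<and> a < m \<and> b < m}
             \<union> {((i, False, 0), (j, False, 0)) |i j. (i, j) \<in> parcs (cycle_graph r)} \<rparr>)"

definition free_nonbipartite ::
  "'b pair_pre_digraph set \<Rightarrow> nat \<Rightarrow> real \<Rightarrow> 'a pair_pre_digraph \<Rightarrow> bool" where
  "free_nonbipartite \<C> n d G \<longleftrightarrow>
     pair_graph G \<and> card (pverts G) = n \<and> family_free \<C> G \<and> \<not> bipartite G \<and>
     real (min_degree G) = d"

end

theory Submission
  imports Defs
begin

text \<open>Let $G$ be a non-bipartite $\mathcal{C}$-free graph with $n$ vertices whose minimum degree $d$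
  satisfies $d \ge n/(2(2\ell+1))$ and $d \ge 2n/(2k+3)$. Each of the two extremal graphs arises as
  the equality case of a counting argument, so bounding $d$ and finding $G$ happen together
  (\<open>extremal_structure\<close>). A shortest odd closed walk $c_0, \dots, c_{g-1}$ of $G$ is a
  chordless cycle, hence $g \ge 2\ell+1$ and $g \ne 2k+1$.

  If $g \ge 2k+3$, then every vertex has at most two neighbours on the cycle, because three would
  create a shorter odd closed walk. Counting the edges at the cycle gives $gd \le 2n$, so
  $g = 2k+3$, everything is tight, and sorting the vertices by their two neighbours on the cycle
  exhibits $G$ as a balanced blow-up (\<open>W_edge_iff\<close>).

  If $g = 2m+1 < 2k+1$, then it is the absence of $C_{2k+1}$ that constrains $G$. Two vertices with
  many common neighbours are joined by paths of \emph{all} even lengths up to $2k$, avoiding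
  any few prescribed vertices (\<open>flex_even\<close>). If $c_i$ and $c_j$ were joined outside the cycle by
  paths of every length of one parity in a suitable range, then one of them would close up with
  an arc of the cycle to a $C_{2k+1}$ (\<open>no_free_links\<close>). Let $P_i$ be the set of vertices that
  have many common neighbours with $c_i$. By the previous remark the $2g$ sets $N(c_i)$, $P_i$ are
  almost disjoint, and none has much fewer than $d$ elements, so $2gd \le n + O(k^4)$
  (\<open>count_pieces\<close>).

  For large $n$ this has two consequences. First, $4g \le 2k+3$, so that there is a lot of room
  between $g$ and $2k+1$. Second, since $g \ge 2\ell+1$ gives $2gd \ge n$, almost every
  vertex lies in one of these sets; a vertex has too many neighbours to send only a few to each
  of them, so every vertex lies in some $P_i$ or in some set $Q_i$ of vertices with many
  neighbours in $P_i$ (\<open>exhaust_pieces\<close>). Thanks to the room, every edge that joins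
  neither $P_i$ to $Q_i$ nor two vertices of the cycle would produce a $C_{2k+1}$. So $G$ consists of
  $g$ bipartite pieces linked only by the cycle, both sides of a piece have at least $d$ vertices,
  and $n \ge 2gd$ exactly. Equality makes the pieces complete and gives $g = 2\ell+1$, which is
  $BC_{2\ell+1}(n)$.

  That the two extremal graphs are $\mathcal{C}$-free follows from projecting their odd cycles to
  $C_{2k+3}$ and $C_{2\ell+1}$: an odd closed walk in $C_r$ has length at least $r$
  (\<open>odd_closed_walk_cycle_graph\<close>, \<open>odd_cycle_in_BC\<close>).\<close>

section \<open>Paths, cycles and flexibly joined vertices\<close>

locale sgraph =
  fixes V :: "'a set" and E :: "('a \<times> 'a) set"
  assumes finV: "finite V"
    and EV: "E \<subseteq> V \<times> V"
    and E_sym: "(u, v) \<in> E \<Longrightarrow> (v, u) \<in> E"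
    and E_irrefl: "(v, v) \<notin> E"
begin

definition nb :: "'a \<Rightarrow> 'a set" where
  "nb v = {w. (v, w) \<in> E}"

definition path :: "'a \<Rightarrow> 'a list \<Rightarrow> 'a \<Rightarrow> bool" where
  "path x p y \<longleftrightarrow> p \<noteq> [] \<and> hd p = x \<and> last p = y \<and> distinct p \<and> successively (\<lambda>u v. (u, v) \<in> E) p"

definition cyc :: "nat \<Rightarrow> bool" where
  "cyc L \<longleftrightarrow> (\<exists>x p y. path x p y \<and> length p = L \<and> (y, x) \<in> E)"

text \<open>Path lengths can be prescribed while avoiding any small set \<open>F\<close>, which makes paths between
  several pairs of vertices composable: the vertices used so far are added to \<open>F\<close>.\<close>

definition flex :: "nat \<Rightarrow> 'a \<Rightarrow> 'a \<Rightarrow> nat \<Rightarrow> bool" where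
  "flex t x y L \<longleftrightarrow> (\<forall>F. finite F \<and> card F \<le> t \<and> x \<notin> F \<and> y \<notin> F \<longrightarrow>
     (\<exists>p. path x p y \<and> length p = Suc L \<and> set p \<inter> F = {}))"

lemma nb_sub: "nb v \<subseteq> V"
  using EV by (auto simp: nb_def)

lemma fin_nb: "finite (nb v)"
  using nb_sub finV finite_subset by blast

lemma nb_commute: "w \<in> nb v \<longleftrightarrow> v \<in> nb w"
  unfolding nb_def using E_sym by blast

lemma path_single: "path x [x] x"
  by (simp add: path_def)

lemma path_ends_in: "path x p y \<Longrightarrow> x \<in> set p \<and> y \<in> set p"
  by (auto simp: path_def)

lemma path_append:
  assumes "path x p y" "path y' q z" "(y, y') \<in> E" "set p \<inter> set q = {}"
  shows "path x (p @ q) z"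
  using assms by (auto simp: path_def successively_append_iff)

lemma path_Cons:
  assumes "path y p z" "(x, y) \<in> E" "x \<notin> set p"
  shows "path x (x # p) z"
  using path_append[OF path_single assms(1,2)] assms(3) by auto

lemma path_join:
  assumes p: "path x p y" and q: "path y q z" and d: "set p \<inter> set q = {y}"
  shows "path x (p @ tl q) z"
proof -
  obtain q' where q': "q = y # q'"
    using q by (cases q) (auto simp: path_def)
  show ?thesis
  proof (cases q')
    case Nil
    then show ?thesis using p q q' by (auto simp: path_def)
  next
    case (Cons a q'')
    have "path a q' z" "(y, a) \<in> E"
      using q q' Cons by (auto simp: path_def)
    moreover have "set p \<inter> set q' = {}"
      using d q q' by (auto simp: path_def)
    ultimately show ?thesis
      using path_append[OF p] q' by simp
  qed
qed

lemma path_rev: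
  assumes "path x p y" shows "path y (rev p) x"
proof -
  have "successively (\<lambda>u v. (v, u) \<in> E) p"
    using assms successively_mono[of "\<lambda>u v. (u, v) \<in> E" p "\<lambda>u v. (v, u) \<in> E"] E_sym
    unfolding path_def by blast
  then show ?thesis
    using assms by (auto simp: path_def hd_rev last_rev)
qed

lemma cyc_of_two_paths:
  assumes p: "path x p y" and q: "path y q x" and d: "set p \<inter> set q = {x, y}" and "x \<noteq> y"
    and len: "length p = Suc a" "length q = Suc b"
  shows "cyc (a + b)"
proof -
  obtain q' where q': "q = q' @ [x]"
    using q by (metis append_butlast_last_id path_def)
  have "q' \<noteq> []" using q q' \<open>x \<noteq> y\<close> by (auto simp: path_def)
  then have 1: "path y q' (last q')" "(last q', x) \<in> E" "x \<notin> set q'"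
    using q q' by (auto simp: path_def successively_append_iff)
  have "set p \<inter> set q' = {y}"
    using d q' 1 path_ends_in[OF 1(1)] by auto
  from path_join[OF p 1(1) this] 1(2) have "cyc (length (p @ tl q'))"
    unfolding cyc_def by blast
  moreover have "length (p @ tl q') = a + b"
    using len q' \<open>q' \<noteq> []\<close> by (cases q') auto
  ultimately show ?thesis by simp
qed

lemma flex_sym: "flex t x y L \<Longrightarrow> flex t y x L"
  unfolding flex_def by (metis length_rev path_rev set_rev)

lemma flexD:
  assumes "flex t x y L" "finite F" "card F \<le> t" "x \<notin> F" "y \<notin> F"
  obtains p where "path x p y" "length p = Suc L" "set p \<inter> F = {}"
  using assms unfolding flex_def by blast

lemma flex_join:
  assumes 1: "flex t x y L1" and 2: "flex t y z L2"
    and F: "finite F" "x \<notin> F" "y \<notin> F" "z \<notin> F" "card F + L1 + 1 \<le> t"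
    and ne: "x \<noteq> z" "y \<noteq> z"
  obtains p where "path x p z" "length p = Suc (L1 + L2)" "set p \<inter> F = {}"
proof -
  have "card (insert z F) \<le> t"
    using F card_insert_le_m1[of "Suc (card F)" F z] by (auto simp: card_insert_if)
  then obtain p where p: "path x p y" "length p = Suc L1" "set p \<inter> insert z F = {}"
    using flexD[OF 1, of "insert z F"] F ne by auto
  have "card (F \<union> (set p - {y})) \<le> card F + card (set p - {y})"
    by (rule card_Un_le)
  also have "\<dots> \<le> card F + (L1 + 1)"
    using p(2) card_Diff1_le[of "set p" y] card_length[of p] by simp
  finally have "card (F \<union> (set p - {y})) \<le> t" using F by simp
  then obtain q where q: "path y q z" "length q = Suc L2" "set q \<inter> (F \<union> (set p - {y})) = {}"
    using flexD[OF 2, of "F \<union> (set p - {y})"] F p by auto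
  have "set p \<inter> set q = {y}"
    using q(3) path_ends_in[OF p(1)] path_ends_in[OF q(1)] by auto
  from path_join[OF p(1) q(1) this] have "path x (p @ tl q) z" .
  moreover have "length (p @ tl q) = Suc (L1 + L2)" using p q by simp
  moreover have "set (p @ tl q) \<inter> F = {}"
    using p(3) q(3) by (cases q) auto
  ultimately show ?thesis using that by blast
qed

lemma flex_edge_join:
  assumes 1: "flex t x u L1" and e: "(u, v) \<in> E" and 2: "flex t v z L2"
    and F: "finite F" "x \<notin> F" "u \<notin> F" "v \<notin> F" "z \<notin> F" "card F + L1 + 2 \<le> t"
    and ne: "x \<noteq> z" "x \<noteq> v" "u \<noteq> z"
  obtains p where "path x p z" "length p = Suc (L1 + 1 + L2)" "set p \<inter> F = {}"
proof -
  have "u \<noteq> v" using e E_irrefl by auto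
  have "card (insert v (insert z F)) \<le> t"
    using F by (auto simp: card_insert_if)
  then obtain p where p: "path x p u" "length p = Suc L1" "set p \<inter> insert v (insert z F) = {}"
    using flexD[OF 1, of "insert v (insert z F)"] F ne \<open>u \<noteq> v\<close> by auto
  have "card (F \<union> set p) \<le> card F + card (set p)"
    by (rule card_Un_le)
  also have "\<dots> \<le> card F + (L1 + 1)"
    using p(2) card_length[of p] by simp
  finally have "card (F \<union> set p) \<le> t" using F by simp
  then obtain q where q: "path v q z" "length q = Suc L2" "set q \<inter> (F \<union> set p) = {}"
    using flexD[OF 2, of "F \<union> set p"] F p by auto
  have "path x (p @ q) z"
    using path_append[OF p(1) q(1) e] q(3) by auto
  moreover have "length (p @ q) = Suc (L1 + 1 + L2)" using p q by simp
  moreover have "set (p @ q) \<inter> F = {}" using p(3) q(3) by auto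
  ultimately show ?thesis using that by blast
qed

text \<open>Deleting, one at a time, vertices of degree at most \<open>T\<close> destroys at most
  \<open>T\<close> edges per vertex, so it cannot exhaust all edges. The sets \<open>A\<close> and \<open>B\<close>
  may overlap: they are the two sides of a bipartite double cover.\<close>

lemma dense_bipartite_core:
  fixes A B :: "'a set" and M :: "('a \<times> 'a) set"
  assumes "finite A" "finite B" "M \<subseteq> A \<times> B" "card M > T * (card A + card B)"
  shows "\<exists>A' \<subseteq> A. \<exists>B' \<subseteq> B. A' \<noteq> {} \<and> (\<forall>a\<in>A'. card {b \<in> B'. (a, b) \<in> M} > T) \<and>
           (\<forall>b\<in>B'. card {a \<in> A'. (a, b) \<in> M} > T)"
  using assms
proof (induction "card A + card B" arbitrary: A B M rule: less_induct)
  case less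
  have finM: "finite M" using less.prems finite_subset by blast
  have "A \<noteq> {}" using less.prems by auto
  consider (good) "(\<forall>a\<in>A. card {b \<in> B. (a, b) \<in> M} > T) \<and> (\<forall>b\<in>B. card {a \<in> A. (a, b) \<in> M} > T)"
    | (badA) a where "a \<in> A" "card {b \<in> B. (a, b) \<in> M} \<le> T"
    | (badB) b where "b \<in> B" "card {a \<in> A. (a, b) \<in> M} \<le> T"
    by (meson not_le)
  then show ?case
  proof cases
    case good
    then show ?thesis using \<open>A \<noteq> {}\<close> by blast
  next
    case badA
    let ?M = "{e \<in> M. fst e \<noteq> a}"
    have "?M \<union> Pair a ` {b \<in> B. (a, b) \<in> M} = M"
      using less.prems by force
    then have "card M \<le> card ?M + card (Pair a ` {b \<in> B. (a, b) \<in> M})"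
      using card_Un_le[of ?M "Pair a ` {b \<in> B. (a, b) \<in> M}"] by simp
    also have "card (Pair a ` {b \<in> B. (a, b) \<in> M}) \<le> T"
      using badA card_image_le[of "{b \<in> B. (a, b) \<in> M}" "Pair a"] less.prems by simp
    finally have cM: "card M \<le> card ?M + T" by simp
    have cA: "card A = Suc (card (A - {a}))"
      using badA less.prems card.remove by metis
    have "card ?M > T * (card (A - {a}) + card B)"
      using cM cA less.prems(4) by (simp add: algebra_simps)
    moreover have "?M \<subseteq> (A - {a}) \<times> B" using less.prems by auto
    ultimately obtain A' B' where 2: "A' \<subseteq> A - {a}" "B' \<subseteq> B" "A' \<noteq> {}"
      and 1: "\<forall>x\<in>A'. card {b \<in> B'. (x, b) \<in> ?M} > T" "\<forall>b\<in>B'. card {x \<in> A'. (x, b) \<in> ?M} > T"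
      using less.hyps[of "A - {a}" B ?M] cA less.prems by auto
    have "{b \<in> B'. (x, b) \<in> ?M} = {b \<in> B'. (x, b) \<in> M}" if "x \<in> A'" for x
      using that \<open>A' \<subseteq> A - {a}\<close> by auto
    moreover have "{x \<in> A'. (x, b) \<in> ?M} = {x \<in> A'. (x, b) \<in> M}" for b
      using \<open>A' \<subseteq> A - {a}\<close> by auto
    ultimately have "\<forall>a\<in>A'. card {b \<in> B'. (a, b) \<in> M} > T" "\<forall>b\<in>B'. card {a \<in> A'. (a, b) \<in> M} > T"
      using 1 by auto
    moreover have "A' \<subseteq> A" "B' \<subseteq> B"
      using 2 by auto
    ultimately show ?thesis using \<open>A' \<noteq> {}\<close> by blast
  next
    case badB
    let ?M = "{e \<in> M. snd e \<noteq> b}"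
    have "?M \<union> (\<lambda>a. (a, b)) ` {a \<in> A. (a, b) \<in> M} = M"
      using less.prems by force
    then have "card M \<le> card ?M + card ((\<lambda>a. (a, b)) ` {a \<in> A. (a, b) \<in> M})"
      using card_Un_le[of ?M "(\<lambda>a. (a, b)) ` {a \<in> A. (a, b) \<in> M}"] by simp
    also have "card ((\<lambda>a. (a, b)) ` {a \<in> A. (a, b) \<in> M}) \<le> T"
      using badB card_image_le[of "{a \<in> A. (a, b) \<in> M}" "\<lambda>a. (a, b)"] less.prems by simp
    finally have cM: "card M \<le> card ?M + T" by simp
    have cB: "card B = Suc (card (B - {b}))"
      using badB less.prems card.remove by metis
    have "card ?M > T * (card A + card (B - {b}))"
      using cM cB less.prems(4) by (simp add: algebra_simps)
    moreover have "?M \<subseteq> A \<times> (B - {b})" using less.prems by auto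
    ultimately obtain A' B' where 2: "A' \<subseteq> A" "B' \<subseteq> B - {b}" "A' \<noteq> {}"
      and 1: "\<forall>x\<in>A'. card {b \<in> B'. (x, b) \<in> ?M} > T" "\<forall>b\<in>B'. card {x \<in> A'. (x, b) \<in> ?M} > T"
      using less.hyps[of A "B - {b}" ?M] cB less.prems by auto
    have "{y \<in> B'. (x, y) \<in> ?M} = {y \<in> B'. (x, y) \<in> M}" for x
      using \<open>B' \<subseteq> B - {b}\<close> by auto
    moreover have "{x \<in> A'. (x, y) \<in> ?M} = {x \<in> A'. (x, y) \<in> M}" if "y \<in> B'" for y
      using that \<open>B' \<subseteq> B - {b}\<close> by auto
    ultimately have "\<forall>a\<in>A'. card {b \<in> B'. (a, b) \<in> M} > T" "\<forall>b\<in>B'. card {a \<in> A'. (a, b) \<in> M} > T"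
      using 1 by auto
    moreover have "A' \<subseteq> A" "B' \<subseteq> B"
      using 2 by auto
    ultimately show ?thesis using \<open>A' \<noteq> {}\<close> by blast
  qed
qed

text \<open>Greedy extension: at each step at most \<open>T\<close> vertices are forbidden, namely \<open>F\<close> and
  the path built so far.\<close>

lemma alternating_path:
  assumes AB: "A \<noteq> {}" "\<forall>a\<in>A. card {b \<in> B. (a, b) \<in> E} > T" "\<forall>b\<in>B. card {a \<in> A. (a, b) \<in> E} > T"
    and F: "finite F" "card F + 2 * s \<le> T"
  shows "\<exists>x p y. path x p y \<and> length p = Suc (2 * s) \<and> x \<in> A \<and> y \<in> A \<and> set p \<inter> F = {}"
  using F(2)
proof (induction s)
  case 0
  obtain a b where "a \<in> A" "b \<in> B"
  proof -
    obtain a where a: "a \<in> A" using AB by blast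
    then have "{b \<in> B. (a, b) \<in> E} \<noteq> {}" using AB(2) by (metis card.empty not_less_zero)
    then show ?thesis using that a by blast
  qed
  then have "card {a \<in> A. (a, b) \<in> E} > card F" using AB(3) 0 by force
  then have "\<not> {a \<in> A. (a, b) \<in> E} \<subseteq> F"
    using F card_mono by (metis not_le)
  then obtain a where "a \<in> A" "a \<notin> F" by blast
  then show ?case using path_single[of a]
    by (intro exI[of _ a] exI[of _ "[a]"]) auto
next
  case (Suc s)
  then obtain x p y where p: "path x p y" "length p = Suc (2 * s)" "x \<in> A" "y \<in> A" "set p \<inter> F = {}"
    by auto
  have new: "\<exists>z \<in> N. z \<notin> F \<and> z \<notin> set q" if "card N > T" "length q \<le> 2 * s + 2" for N q
  proof (rule ccontr)
    assume "\<not> ?thesis"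
    then have "N \<subseteq> F \<union> set q" by blast
    then have "card N \<le> card F + card (set q)"
      using F card_mono[of "F \<union> set q" N] card_Un_le[of F "set q"] by simp
    then show False using that card_length[of q] Suc.prems by simp
  qed
  obtain b where b: "b \<in> B" "(y, b) \<in> E" "b \<notin> F" "b \<notin> set p"
    using new[of "{b \<in> B. (y, b) \<in> E}" p] AB p by auto
  obtain a where a: "a \<in> A" "(a, b) \<in> E" "a \<notin> F" "a \<notin> set (p @ [b])"
    using new[of "{a \<in> A. (a, b) \<in> E}" "p @ [b]"] AB p b by auto
  have "path x (p @ [b]) b"
    using path_append[OF p(1) path_single b(2)] b by auto
  from path_append[OF this path_single E_sym[OF a(2)]] a
  have "path x ((p @ [b]) @ [a]) a" by auto
  then show ?case using p b a by (intro exI[of _ x] exI[of _ "(p @ [b]) @ [a]"] exI[of _ a]) auto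
qed

text \<open>The common neighbourhood \<open>Z\<close> of \<open>x\<close> and \<open>y\<close> sends at least \<open>K * d\<close> edges into \<open>V\<close>. So it
  spans, together with \<open>V\<close>, a dense bipartite graph, which contains a path of every even
  length below \<open>2 * k\<close> with both ends in \<open>Z\<close>; its ends are adjacent to \<open>x\<close> and to \<open>y\<close>.\<close>

lemma flex_even:
  assumes deg: "\<And>v. v \<in> V \<Longrightarrow> d \<le> card (nb v)"
    and K: "K * d > (t + 2 * k + 2) * (K + card V)"
    and xy: "x \<noteq> y" "K \<le> card (nb x \<inter> nb y)" and s: "1 \<le> s" "s \<le> k"
  shows "flex t x y (2 * s)"
  unfolding flex_def
proof (intro allI impI)
  fix F assume F: "finite F \<and> card F \<le> t \<and> x \<notin> F \<and> y \<notin> F"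
  let ?T = "t + 2 * k + 2"
  obtain Z where Z: "Z \<subseteq> nb x \<inter> nb y" "card Z = K" "finite Z"
    using obtain_subset_with_card_n[OF xy(2)] by blast
  let ?M = "Sigma Z nb"
  have "card ?M = (\<Sum>z\<in>Z. card (nb z))"
    using Z fin_nb by simp
  also have "\<dots> \<ge> (\<Sum>z\<in>Z. d)"
    using Z nb_sub by (intro sum_mono deg) blast
  finally have "card ?M > ?T * (card Z + card V)"
    using K Z by simp
  moreover have "?M \<subseteq> Z \<times> V" using nb_sub by blast
  ultimately obtain A B where AB: "A \<subseteq> Z" "B \<subseteq> V" "A \<noteq> {}"
    "\<forall>a\<in>A. card {b \<in> B. (a, b) \<in> ?M} > ?T" "\<forall>b\<in>B. card {a \<in> A. (a, b) \<in> ?M} > ?T"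
    using dense_bipartite_core[of Z V ?M ?T] Z finV by blast
  have "{b \<in> B. (a, b) \<in> ?M} = {b \<in> B. (a, b) \<in> E}" if "a \<in> A" for a
    using that AB by (auto simp: nb_def)
  moreover have "{a \<in> A. (a, b) \<in> ?M} = {a \<in> A. (a, b) \<in> E}" for b
    using AB by (auto simp: nb_def)
  moreover have "card (insert x (insert y F)) + 2 * (s - 1) \<le> ?T"
    using F s by (auto simp: card_insert_if)
  ultimately obtain u p w where p: "path u p w" "length p = Suc (2 * (s - 1))" "u \<in> A" "w \<in> A"
    "set p \<inter> insert x (insert y F) = {}"
    using alternating_path[where A = A and B = B and T = ?T and F = "insert x (insert y F)" and s = "s - 1"] AB F by auto
  have "(x, u) \<in> E" "(w, y) \<in> E"
    using p AB Z nb_commute by (auto simp: nb_def)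
  then have "path x (x # p @ [y]) y"
    using path_Cons[OF path_append[OF p(1) path_single]] p xy by auto
  moreover have "length (x # p @ [y]) = Suc (2 * s)" using p s by simp
  ultimately show "\<exists>p. path x p y \<and> length p = Suc (2 * s) \<and> set p \<inter> F = {}"
    using p F by (intro exI[of _ "x # p @ [y]"]) auto
qed

end

section \<open>Shortest odd closed walks\<close>

lemma mod_add_right_cancel_nat:
  fixes a b c g :: nat
  shows "(a + c) mod g = (b + c) mod g \<longleftrightarrow> a mod g = b mod g"
proof -
  have "a + c + q1 = b + c + q2 \<longleftrightarrow> a + q1 = b + q2" for q1 q2 by auto
  then show ?thesis by (simp only: nat_mod_eq_iff)
qed

lemma eq_Suc_mod_iff:
  fixes i j g :: nat
  assumes "i < g" "j < g"
  shows "i = Suc j mod g \<longleftrightarrow> j = (i + g - 1) mod g"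
proof -
  have "i = Suc j mod g \<longleftrightarrow> (i + g - 1 + 1) mod g = (j + 1) mod g"
    using assms by auto
  also have "\<dots> \<longleftrightarrow> (i + g - 1) mod g = j mod g" by (rule mod_add_right_cancel_nat)
  finally show ?thesis using assms by auto
qed

context sgraph
begin

lemma relpow_sym:
  assumes "(x, y) \<in> E ^^ n" shows "(y, x) \<in> E ^^ n"
  using assms
proof (induction n arbitrary: y)
  case (Suc n)
  then obtain z where z: "(x, z) \<in> E ^^ n" "(z, y) \<in> E" by auto
  have "(z, x) \<in> E ^^ n" using Suc.IH z(1) .
  then show ?case using E_sym[OF z(2)] relpow_Suc_I2 by metis
qed simp

lemma relpow_trans:
  "(x, y) \<in> E ^^ a \<Longrightarrow> (y, z) \<in> E ^^ b \<Longrightarrow> (x, z) \<in> E ^^ (a + b)"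
  by (auto simp: relpow_add)

lemma edge_relpow: "(x, y) \<in> E \<Longrightarrow> (x, y) \<in> E ^^ 1"
  by simp

text \<open>In each component, colour the vertices by the parity of the walks from a root. The two ends
  of an edge inside a colour class are reached by walks of equal parity, and the edge closes these
  two walks up to an odd one.\<close>

lemma bipartition_if_no_odd_closed_walk:
  assumes no: "\<And>L x. odd L \<Longrightarrow> (x, x) \<notin> E ^^ L"
  shows "\<exists>U W. V = U \<union> W \<and> U \<inter> W = {} \<and> E \<subseteq> U \<times> W \<union> W \<times> U"
proof -
  define r where "r v = (SOME u. (v, u) \<in> E\<^sup>*)" for v
  define U where "U = {v \<in> V. \<exists>L. even L \<and> (r v, v) \<in> E ^^ L}"
  have r: "\<exists>L. (r v, v) \<in> E ^^ L" for v
  proof -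
    have "(v, r v) \<in> E\<^sup>*" unfolding r_def by (rule someI) (rule rtrancl_refl)
    then show ?thesis using rtrancl_imp_relpow relpow_sym by metis
  qed
  have req: "r u = r v" if "(u, v) \<in> E" for u v
  proof -
    have "(u, w) \<in> E\<^sup>* \<longleftrightarrow> (v, w) \<in> E\<^sup>*" for w
      using that E_sym[OF that] converse_rtrancl_into_rtrancl by metis
    then show ?thesis by (simp add: r_def)
  qed
  have "E \<subseteq> U \<times> (V - U) \<union> (V - U) \<times> U"
  proof
    fix e assume "e \<in> E"
    then obtain u v where e: "e = (u, v)" and uv: "(u, v) \<in> E" "u \<in> V" "v \<in> V"
      using EV by auto
    note ruv = req[OF uv(1)]
    have cl: "even a \<noteq> even b" if "(r u, u) \<in> E ^^ a" "(r v, v) \<in> E ^^ b" for a b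
    proof
      assume eq: "even a = even b"
      have "(r u, v) \<in> E ^^ (a + 1)" using relpow_trans[OF that(1) edge_relpow[OF uv(1)]] .
      from relpow_trans[OF this relpow_sym[OF that(2)]] ruv
      have "(r u, r u) \<in> E ^^ (a + 1 + b)" by simp
      moreover have "odd (a + 1 + b)" using eq by auto
      ultimately show False using no by blast
    qed
    obtain a b where ab: "(r u, u) \<in> E ^^ a" "(r v, v) \<in> E ^^ b" using r by blast
    show "e \<in> U \<times> (V - U) \<union> (V - U) \<times> U"
    proof (cases "even a")
      case True
      then have "u \<in> U" using ab uv by (auto simp: U_def)
      moreover have "v \<notin> U" using cl[OF ab(1)] True by (auto simp: U_def)
      ultimately show ?thesis using e uv by auto
    next
      case False
      then have "v \<in> U" using ab uv cl by (auto simp: U_def)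
      moreover have "u \<notin> U" using cl[OF _ ab(2)] cl[OF ab] False by (auto simp: U_def)
      ultimately show ?thesis using e uv by auto
    qed
  qed
  moreover have "V = U \<union> (V - U)" by (auto simp: U_def)
  ultimately show ?thesis by blast
qed

lemma sum_card_nb:
  assumes "finite I"
  shows "(\<Sum>i\<in>I. card (nb (c i))) = (\<Sum>v\<in>V. card {i \<in> I. (v, c i) \<in> E})"
proof -
  have "(\<Sum>i\<in>I. card (nb (c i))) = (\<Sum>i\<in>I. \<Sum>v\<in>V. if (v, c i) \<in> E then 1 else 0)"
  proof (rule sum.cong[OF refl])
    fix i
    have "nb (c i) = {v \<in> V. (v, c i) \<in> E}"
      using nb_sub nb_commute by (auto simp: nb_def)
    then show "card (nb (c i)) = (\<Sum>v\<in>V. if (v, c i) \<in> E then 1 else 0)"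
      using finV by (simp add: sum.If_cases Int_def)
  qed
  also have "\<dots> = (\<Sum>v\<in>V. \<Sum>i\<in>I. if (v, c i) \<in> E then 1 else 0)"
    by (rule sum.swap)
  also have "\<dots> = (\<Sum>v\<in>V. card {i \<in> I. (v, c i) \<in> E})"
    using assms by (simp add: sum.If_cases Int_def)
  finally show ?thesis .
qed

end

text \<open>The walk is extended periodically to all of \<open>nat\<close>, so that arcs passing through position 0
  need no separate treatment.\<close>

locale shortest_odd_walk = sgraph V E for V :: "'a set" and E +
  fixes c :: "nat \<Rightarrow> 'a" and g :: nat
  assumes odd_g: "odd g"
    and c_adj: "(c i, c (Suc i)) \<in> E"
    and c_period: "c (i + g) = c i"
    and shortest: "odd L \<Longrightarrow> (x, x) \<in> E ^^ L \<Longrightarrow> g \<le> L"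

context sgraph
begin

lemma shortest_odd_walk_exists:
  assumes "odd L0" "(x0, x0) \<in> E ^^ L0"
  obtains c g where "shortest_odd_walk V E c g"
proof -
  define P where "P L \<longleftrightarrow> odd L \<and> (\<exists>x. (x, x) \<in> E ^^ L)" for L
  define g where "g = (LEAST L. P L)"
  have "P g" unfolding g_def by (rule LeastI[of P L0]) (use assms in \<open>auto simp: P_def\<close>)
  then obtain x where x: "odd g" "(x, x) \<in> E ^^ g" by (auto simp: P_def)
  then obtain f where f: "f 0 = x" "f g = x" "\<And>i. i < g \<Longrightarrow> (f i, f (Suc i)) \<in> E"
    by (auto simp: relpow_fun_conv)
  have g0: "0 < g" using x(1) by (auto intro: gr0I)
  have "(f (i mod g), f (Suc i mod g)) \<in> E" for i
    using f(3)[of "i mod g"] g0 f(1,2) by (auto simp: mod_Suc)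
  moreover have "g \<le> L" if "odd L" "(y, y) \<in> E ^^ L" for L y
    unfolding g_def by (rule Least_le) (use that in \<open>auto simp: P_def\<close>)
  ultimately have "shortest_odd_walk V E (\<lambda>i. f (i mod g)) g"
    using x(1) by unfold_locales auto
  then show ?thesis using that by blast
qed

end

context shortest_odd_walk
begin

lemma c_walk: "(c i, c (i + n)) \<in> E ^^ n"
  by (induction n) (use c_adj in auto)

lemma g_ge3: "3 \<le> g"
proof (rule ccontr)
  assume "\<not> 3 \<le> g"
  then have "g = 1" using odd_g by (cases g; cases "g - 1") (auto, presburger)
  then show False using c_adj[of 0] c_period[of 0] E_irrefl by simp
qed

lemma c_in_V: "c i \<in> V"
  using c_adj EV by blast

lemma c_mod: "c i = c (i mod g)"
proof -
  have "c (j + m * g) = c j" for j m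
    by (induction m) (use c_period in \<open>simp_all add: add.assoc[symmetric] add.commute[of g]\<close>)
  then show ?thesis by (metis mod_mult_div_eq mult.commute)
qed

text \<open>Both arcs between two positions close up to closed walks; the odd one is too short.\<close>

lemma c_inj_less:
  assumes "i < j" "j < g" shows "c i \<noteq> c j"
proof
  assume eq: "c i = c j"
  have 1: "(c i, c i) \<in> E ^^ (j - i)" using c_walk[of i "j - i"] eq assms by simp
  have "(c j, c (j + (g - (j - i)))) \<in> E ^^ (g - (j - i))" by (rule c_walk)
  moreover have "j + (g - (j - i)) = i + g" using assms by simp
  ultimately have 2: "(c i, c i) \<in> E ^^ (g - (j - i))" using eq c_period by metis
  show False
  proof (cases "odd (j - i)")
    case True then show False using shortest[OF True 1] assms by simp
  next
    case False
    then have "odd (g - (j - i))" using odd_g assms by auto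
    then show False using shortest[OF _ 2] assms by simp
  qed
qed

lemma c_inj: "inj_on c {..<g}"
  by (rule linorder_inj_onI) (use c_inj_less in auto)

lemma c_eq_iff: "c i = c j \<longleftrightarrow> i mod g = j mod g"
proof -
  have g0: "0 < g" using g_ge3 by simp
  have "c (i mod g) = c (j mod g) \<longleftrightarrow> i mod g = j mod g"
    using c_inj g0 by (auto simp: inj_on_eq_iff)
  then show ?thesis by (metis c_mod)
qed

lemma arc_back: "i < j \<Longrightarrow> j < g \<Longrightarrow> (c j, c i) \<in> E ^^ (g - (j - i))"
  using c_walk[of j "g - (j - i)"] c_period[of i] by (simp add: add.commute)

text \<open>A chord splits the cycle into an odd and an even arc, and closes the even one to an odd walk.
  By minimality that arc misses only one edge of the cycle.\<close>

lemma chord_consecutive: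
  assumes "i < j" "j < g" "(c i, c j) \<in> E" shows "j = i + 1 \<or> i = 0 \<and> j = g - 1"
proof -
  note ij = edge_relpow[OF assms(3)] and ji = edge_relpow[OF E_sym[OF assms(3)]]
  have fw: "(c i, c j) \<in> E ^^ (j - i)" using c_walk[of i "j - i"] assms by simp
  have 1: "(c i, c i) \<in> E ^^ (j - i + 1)"
    using relpow_trans[OF fw ji] .
  have 2: "(c j, c j) \<in> E ^^ (g - (j - i) + 1)"
    using relpow_trans[OF arc_back[OF assms(1,2)] ij] .
  show ?thesis
  proof (cases "odd (j - i + 1)")
    case True then show ?thesis using shortest[OF True 1] assms by arith
  next
    case False
    then have "odd (g - (j - i) + 1)" using odd_g assms by auto
    from shortest[OF this 2] show ?thesis using assms by arith
  qed
qed

text \<open>Here the odd one of the two arcs is closed by two edges; by minimality the complementary even arc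
  has length 2.\<close>

lemma common_nb_less:
  assumes "i < j" "j < g" "(v, c i) \<in> E" "(v, c j) \<in> E"
  shows "j = i + 2 \<or> j + 2 = i + g"
proof -
  note vi = edge_relpow[OF assms(3)] edge_relpow[OF E_sym[OF assms(3)]]
    and vj = edge_relpow[OF assms(4)] edge_relpow[OF E_sym[OF assms(4)]]
  have fw: "(c i, c j) \<in> E ^^ (j - i)" using c_walk[of i "j - i"] assms by simp
  have 1: "(v, v) \<in> E ^^ (1 + (j - i) + 1)"
    using relpow_trans[OF relpow_trans[OF vi(1) fw] vj(2)] .
  have 2: "(v, v) \<in> E ^^ (1 + (g - (j - i)) + 1)"
    using relpow_trans[OF relpow_trans[OF vj(1) arc_back[OF assms(1,2)]] vi(2)] .
  show ?thesis
  proof (cases "odd (1 + (j - i) + 1)")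
    case True
    then have "g \<le> j - i + 2" using shortest[OF True 1] by simp
    moreover have "odd (j - i)" using True by simp
    ultimately show ?thesis using assms(1,2) odd_g by presburger
  next
    case False
    then have "odd (1 + (g - (j - i)) + 1)" using odd_g assms by auto
    then have "j - i \<le> 2" using shortest[OF _ 2] assms by simp
    moreover have "even (j - i)" using False by simp
    ultimately show ?thesis using assms(1,2) by presburger
  qed
qed

lemma chord_iff:
  assumes "i < g" "j < g" shows "(c i, c j) \<in> E \<longleftrightarrow> j = Suc i mod g \<or> i = Suc j mod g"
proof
  assume "(c i, c j) \<in> E"
  moreover from this have "i \<noteq> j" using E_irrefl by auto
  ultimately show "j = Suc i mod g \<or> i = Suc j mod g"
    using chord_consecutive[of i j] chord_consecutive[of j i] E_sym[of "c i" "c j"] assms by (cases "i < j") auto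
next
  assume "j = Suc i mod g \<or> i = Suc j mod g"
  then show "(c i, c j) \<in> E"
    using c_adj[of i] c_adj[of j] c_mod[of "Suc i"] c_mod[of "Suc j"] E_sym by metis
qed

definition C :: "'a set" where
  "C = c ` {..<g}"

lemma forward_arc:
  assumes "i \<le> j" "j < i + g"
  shows "path (c i) (map c [i..<Suc j]) (c j)" "length (map c [i..<Suc j]) = Suc (j - i)"
    "set (map c [i..<Suc j]) \<subseteq> C"
proof -
  have "inj_on c {i..j}"
  proof (rule linorder_inj_onI)
    fix a b assume "a < b" "a \<in> {i..j}" "b \<in> {i..j}"
    then have "b - a < g" "a < b" using assms by auto
    show "c a \<noteq> c b"
    proof
      assume "c a = c b"
      then have "(0 + a) mod g = ((b - a) + a) mod g" using \<open>a < b\<close> by (simp add: c_eq_iff)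
      then have "0 mod g = (b - a) mod g" by (simp only: mod_add_right_cancel_nat)
      then show False using \<open>b - a < g\<close> \<open>a < b\<close> by simp
    qed
  qed auto
  then have "distinct (map c [i..<Suc j])"
    by (simp add: distinct_map atLeastLessThanSuc_atLeastAtMost del: upt_Suc)
  moreover have "successively (\<lambda>u v. (u, v) \<in> E) (map c [i..<Suc j])"
    unfolding successively_conv_nth
  proof (intro allI impI)
    fix a assume "Suc a < length (map c [i..<Suc j])"
    then have "map c [i..<Suc j] ! a = c (i + a)" "map c [i..<Suc j] ! Suc a = c (Suc (i + a))"
      using nth_map_upt by (simp_all del: upt_Suc)
    then show "(map c [i..<Suc j] ! a, map c [i..<Suc j] ! Suc a) \<in> E" using c_adj by simp
  qed
  moreover have "hd (map c [i..<Suc j]) = c i"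
    using assms by (simp add: hd_map del: upt_Suc)
  ultimately show "path (c i) (map c [i..<Suc j]) (c j)"
    using assms by (auto simp: path_def)
  show "length (map c [i..<Suc j]) = Suc (j - i)" using assms by simp
  show "set (map c [i..<Suc j]) \<subseteq> C"
  proof
    fix x assume "x \<in> set (map c [i..<Suc j])"
    then obtain a where "x = c a" by auto
    then have "x = c (a mod g)" using c_mod by simp
    then show "x \<in> C" using g_ge3 by (auto simp: C_def)
  qed
qed

lemma cyc_g: "cyc g"
proof -
  have "path (c 0) (map c [0..<Suc (g - 1)]) (c (g - 1))"
    by (rule forward_arc) (use g_ge3 in auto)
  moreover have "(c (g - 1), c 0) \<in> E"
    using c_adj[of "g - 1"] c_period[of 0] g_ge3 by simp
  moreover have "length (map c [0..<Suc (g - 1)]) = g" using g_ge3 by simp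
  ultimately show ?thesis unfolding cyc_def by blast
qed

end

section \<open>Large odd girth: blow-ups of a cycle\<close>

locale long_odd_girth = shortest_odd_walk +
  assumes g_ge7: "7 \<le> g"
begin

text \<open>Two neighbours of a vertex on a shortest odd cycle are at cyclic distance 2, and
  three positions at pairwise distance 2 exist only on a hexagon (or a triangle).\<close>

lemma nbs_on_cycle:
  assumes "i < g" "j < g" "i \<noteq> j" "(v, c i) \<in> E" "(v, c j) \<in> E"
  shows "{l. l < g \<and> (v, c l) \<in> E} = {i, j}"
proof (rule ccontr)
  assume "\<not> ?thesis"
  then obtain l where l: "l < g" "(v, c l) \<in> E" "l \<noteq> i" "l \<noteq> j" using assms by blast
  have d: "b = a + 2 \<or> a = b + 2 \<or> b + 2 = a + g \<or> a + 2 = b + g"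
    if "a < g" "b < g" "a \<noteq> b" "(v, c a) \<in> E" "(v, c b) \<in> E" for a b
    using common_nb_less[of a b v] common_nb_less[of b a v] that by (cases "a < b") auto
  show False
    using d[of i j] d[of i l] d[of j l] assms l g_ge7 by auto
qed

lemma card_nbs_on_cycle_le: "card {i \<in> {..<g}. (v, c i) \<in> E} \<le> 2"
proof (rule ccontr)
  assume a: "\<not> ?thesis"
  then obtain T where "T \<subseteq> {i \<in> {..<g}. (v, c i) \<in> E}" "card T = 2"
    using obtain_subset_with_card_n[of 2 "{i \<in> {..<g}. (v, c i) \<in> E}"] by auto
  then obtain i j where "i \<noteq> j" "i < g" "j < g" "(v, c i) \<in> E" "(v, c j) \<in> E"
    by (auto simp: card_2_iff)
  then have "{i \<in> {..<g}. (v, c i) \<in> E} = {i, j}" using nbs_on_cycle by auto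
  then show False using a by (simp add: card_insert_if split: if_splits)
qed

text \<open>Double count the edges between the cycle and the whole graph.\<close>

lemma girth_degree_bound:
  assumes deg: "\<And>v. v \<in> V \<Longrightarrow> d \<le> card (nb v)"
  shows "g * d \<le> 2 * card V"
proof -
  have "g * d = (\<Sum>i<g. d)" by simp
  also have "\<dots> \<le> (\<Sum>i<g. card (nb (c i)))" by (intro sum_mono deg c_in_V)
  also have "\<dots> = (\<Sum>v\<in>V. card {i \<in> {..<g}. (v, c i) \<in> E})" by (rule sum_card_nb) simp
  also have "\<dots> \<le> (\<Sum>v\<in>V. 2)" by (intro sum_mono card_nbs_on_cycle_le)
  finally show ?thesis by simp
qed

end

locale extremal_long_girth = long_odd_girth +
  fixes d :: nat
  assumes deg: "v \<in> V \<Longrightarrow> d \<le> card (nb v)"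
    and tight: "g * d = 2 * card V"
begin

lemma
  shows deg_c: "card (nb (c i)) = d"
    and card_nbs_on_cycle: "v \<in> V \<Longrightarrow> card {i \<in> {..<g}. (v, c i) \<in> E} = 2"
proof -
  have eq: "(\<Sum>i<g. card (nb (c i))) = (\<Sum>v\<in>V. card {i \<in> {..<g}. (v, c i) \<in> E})"
    by (rule sum_card_nb) simp
  have le1: "(\<Sum>i<g. d) \<le> (\<Sum>i<g. card (nb (c i)))" by (intro sum_mono deg c_in_V)
  have le2: "(\<Sum>v\<in>V. card {i \<in> {..<g}. (v, c i) \<in> E}) \<le> (\<Sum>v\<in>V. 2)"
    by (intro sum_mono card_nbs_on_cycle_le)
  have t: "(\<Sum>i<g. d) = (\<Sum>v\<in>V. 2)" using tight by simp
  have "\<forall>i\<in>{..<g}. d = card (nb (c i))"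
  proof (rule ccontr)
    assume "\<not> ?thesis"
    then obtain i where "i < g" "d < card (nb (c i))"
      using deg c_in_V by (metis lessThan_iff nat_less_le)
    then have "(\<Sum>i<g. d) < (\<Sum>i<g. card (nb (c i)))"
      by (intro sum_strict_mono_ex1) (auto intro: deg c_in_V)
    then show False using eq le2 t by simp
  qed
  then show "card (nb (c i)) = d"
    using c_mod[of i] g_ge3 by auto
  show "card {i \<in> {..<g}. (v, c i) \<in> E} = 2" if "v \<in> V"
  proof (rule ccontr)
    assume "\<not> ?thesis"
    then have "card {i \<in> {..<g}. (v, c i) \<in> E} < 2" using card_nbs_on_cycle_le[of v] by simp
    then have "(\<Sum>v\<in>V. card {i \<in> {..<g}. (v, c i) \<in> E}) < (\<Sum>v\<in>V. 2)"
      using that finV by (intro sum_strict_mono_ex1) (use card_nbs_on_cycle_le in auto)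
    then show False using eq le1 t by simp
  qed
qed

text \<open>The class of \<open>c (i + 1)\<close>; shifting the index by one avoids subtraction.\<close>

definition W :: "nat \<Rightarrow> 'a set" where
  "W i = {v \<in> V. (v, c i) \<in> E \<and> (v, c (i + 2)) \<in> E}"

lemma W_mod: "W i = W (i mod g)"
proof -
  have "c (i mod g) = c i" "c (i mod g + 2) = c (i + 2)"
    unfolding c_eq_iff by (simp_all add: mod_add_left_eq del: add_2_eq_Suc')
  then show ?thesis by (simp add: W_def del: add_2_eq_Suc')
qed

lemma W_nbs:
  assumes "i < g" "v \<in> W i"
  shows "{l. l < g \<and> (v, c l) \<in> E} = {i, (i + 2) mod g}"
proof -
  have "(i + 2) mod g \<noteq> i"
    using assms g_ge7 by (cases "i + 2 < g") (auto simp: mod_if)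
  then show ?thesis
    using nbs_on_cycle[of i "(i + 2) mod g" v] assms g_ge7 c_mod[of "i + 2"] by (auto simp: W_def)
qed

lemma W_disjoint:
  assumes "i < g" "j < g" "i \<noteq> j" shows "W i \<inter> W j = {}"
proof (rule ccontr)
  assume "\<not> ?thesis"
  then obtain v where "v \<in> W i" "v \<in> W j" by blast
  then have "{i, (i + 2) mod g} = {j, (j + 2) mod g}"
    using W_nbs[OF assms(1), of v] W_nbs[OF assms(2), of v] by blast
  then have "i = (j + 2) mod g" "j = (i + 2) mod g" using assms by (auto simp: doubleton_eq_iff)
  then show False using assms g_ge7 by (auto simp: mod_if split: if_splits)
qed

lemma W_cover:
  assumes "v \<in> V" obtains i where "i < g" "v \<in> W i"
proof -
  obtain i j where ij: "i \<noteq> j" "{i \<in> {..<g}. (v, c i) \<in> E} = {i, j}"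
    using card_nbs_on_cycle[OF assms] by (auto simp: card_2_iff)
  then have in_g: "i < g" "j < g" "(v, c i) \<in> E" "(v, c j) \<in> E" by auto
  have *: "\<exists>i<g. v \<in> W i" if "i < j" "i < g" "j < g" "(v, c i) \<in> E" "(v, c j) \<in> E" for i j
    using common_nb_less[OF that(1,3-5)]
  proof
    assume "j = i + 2"
    then have "v \<in> W i" using that assms by (auto simp: W_def)
    then show ?thesis using that by blast
  next
    assume "j + 2 = i + g"
    then have "c (j + 2) = c i" using c_period by simp
    then have "v \<in> W j" using that assms by (auto simp: W_def)
    then show ?thesis using that by blast
  qed
  show ?thesis using *[of i j] *[of j i] in_g ij(1) that by (cases "i < j") auto
qed

lemma nb_c: "nb (c (i + 2)) = W i \<union> W (i + 2)"
proof
  show "W i \<union> W (i + 2) \<subseteq> nb (c (i + 2))"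
    using nb_commute by (auto simp: W_def nb_def)
  show "nb (c (i + 2)) \<subseteq> W i \<union> W (i + 2)"
  proof
    fix v assume "v \<in> nb (c (i + 2))"
    then have v: "(v, c (i + 2)) \<in> E" "v \<in> V" using nb_commute nb_sub by (auto simp: nb_def)
    obtain l where l: "l < g" "v \<in> W l" using W_cover[OF v(2)] .
    have "(i + 2) mod g \<in> {l. l < g \<and> (v, c l) \<in> E}"
      using v c_mod[of "i + 2"] l by auto
    then have "(i + 2) mod g = l \<or> (i + 2) mod g = (l + 2) mod g"
      using W_nbs[OF l] by auto
    then show "v \<in> W i \<union> W (i + 2)"
    proof
      assume "(i + 2) mod g = l"
      then show ?thesis using l W_mod[of "i + 2"] by simp
    next
      assume "(i + 2) mod g = (l + 2) mod g"
      then have "i mod g = l mod g"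
        by (simp only: mod_add_right_cancel_nat)
      then show ?thesis using l W_mod[of i] by simp
    qed
  qed
qed

text \<open>The neighbourhood of \<open>c (i + 2)\<close> consists of two classes and has exactly \<open>d\<close> elements.\<close>

lemma W_size_step: "card (W i) + card (W (i + 2)) = d"
proof -
  have "i mod g \<noteq> (i + 2) mod g"
  proof
    assume "i mod g = (i + 2) mod g"
    then have "(0 + i) mod g = (2 + i) mod g" by (simp only: add.commute add_0)
    then have "0 mod g = 2 mod g" by (simp only: mod_add_right_cancel_nat)
    then show False using g_ge7 by simp
  qed
  then have "W i \<inter> W (i + 2) = {}"
    using W_disjoint[of "i mod g" "(i + 2) mod g"] W_mod[of i] W_mod[of "i + 2"] g_ge7 by simp
  moreover have "finite (W i)" for i using finV by (simp add: W_def)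
  ultimately show ?thesis
    using deg_c[of "i + 2"] nb_c[of i] by (simp add: card_Un_disjoint)
qed

text \<open>By the previous lemma the class sizes have period 4. They also have period \<open>g\<close>, which is
  coprime to 4, so they are constant.\<close>

lemma W_size: "2 * card (W i) = d"
proof -
  define w where "w i = card (W i)" for i
  have step: "w (i + 4) = w i" for i
    using W_size_step[of i] W_size_step[of "i + 2"] by (simp add: w_def eval_nat_numeral)
  have steps: "w (i + 4 * q) = w i" for i q
  proof (induction q)
    case (Suc q)
    then show ?case using step[of "i + 4 * q"] by (simp add: algebra_simps)
  qed simp
  have per: "w (i + g) = w i" for i
    using W_mod[of "i + g"] W_mod[of i] by (simp add: w_def)
  have "w (i + 1) = w i" for i
  proof -
    have "\<exists>q. g = 4 * q + 1 \<or> g = 4 * q + 3" using odd_g by presburger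
    then obtain q where "g = 4 * q + 1 \<or> g = 4 * q + 3" by blast
    then show ?thesis
    proof
      assume "g = 4 * q + 1"
      then show ?thesis using steps[of "i + 1" q] per[of i] by (simp add: algebra_simps)
    next
      assume g: "g = 4 * q + 3"
      have "w (j + 3) = w j" for j
        using steps[of "j + 3" q] per[of j] g by (simp add: algebra_simps)
      from this[of "i + 1"] show ?thesis using step[of i] by (simp add: algebra_simps)
    qed
  qed
  from this[of i] this[of "i + 1"] have "w (i + 2) = w i" by simp
  then show ?thesis using W_size_step[of i] by (simp add: w_def)
qed

text \<open>An edge between classes at cyclic distance other than 1 would close an odd walk
  shorter than \<open>g\<close>: both ends have two neighbours on the cycle, and one goes back along the arc
  of suitable parity, starting and ending at the neighbours that make it shortest.\<close>

lemma W_edge_forward: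
  assumes "i \<le> j" "j < i + g" "x \<in> W i" "y \<in> W j" "(x, y) \<in> E"
  shows "j = i + 1 \<or> j + 1 = i + g"
proof -
  have x: "(x, c i) \<in> E ^^ 1" "(c i, x) \<in> E ^^ 1" "(x, c (i + 2)) \<in> E ^^ 1" "(c (i + 2), x) \<in> E ^^ 1"
    and y: "(y, c j) \<in> E ^^ 1" "(c j, y) \<in> E ^^ 1" "(y, c (j + 2)) \<in> E ^^ 1" "(c (j + 2), y) \<in> E ^^ 1"
    and xy: "(x, y) \<in> E ^^ 1" "(y, x) \<in> E ^^ 1"
    using assms(3-5) E_sym by (auto simp: W_def)
  define a where "a = j - i"
  have a: "j = i + a" "a < g" using assms by (auto simp: a_def)
  show ?thesis
  proof (cases "even a")
    case True
    show ?thesis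
    proof (cases "a = 0")
      case True
      have "(x, x) \<in> E ^^ (1 + 1 + 1)"
        using relpow_trans[OF relpow_trans[OF xy(1) y(1)], of x 1] x(2) a True by simp
      then show ?thesis using shortest[of "1 + 1 + 1" x] g_ge7 by simp
    next
      case False
      then have a2: "2 \<le> a" using True by presburger
      have "(c (i + 2), c j) \<in> E ^^ (a - 2)" 
      proof -
        have "i + 2 + (a - 2) = j" using a a2 by simp
        then show ?thesis using c_walk by metis
      qed
      from relpow_trans[OF relpow_trans[OF relpow_trans[OF x(3) this] y(2)] xy(2)]
      have "(x, x) \<in> E ^^ (1 + (a - 2) + 1 + 1)" .
      moreover have "odd (1 + (a - 2) + 1 + 1)" using True a2 by simp
      ultimately have "g \<le> 1 + (a - 2) + 1 + 1" using shortest by blast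
      then show ?thesis using a a2 by auto
    qed
  next
    case False
    then have a2: "a + 2 \<le> g" using a odd_g by presburger
    have "(c (j + 2), c i) \<in> E ^^ (g - a - 2)"
    proof -
      have "j + 2 + (g - a - 2) = i + g" using a a2 by simp
      then show ?thesis using c_walk[of "j + 2" "g - a - 2"] c_period[of i] by metis
    qed
    from relpow_trans[OF relpow_trans[OF relpow_trans[OF y(3) this] x(2)] xy(1)]
    have "(y, y) \<in> E ^^ (1 + (g - a - 2) + 1 + 1)" .
    moreover have "odd (1 + (g - a - 2) + 1 + 1)" using False a2 odd_g by simp
    ultimately have "g \<le> 1 + (g - a - 2) + 1 + 1" using shortest by blast
    then have "a \<le> 1" using a2 by arith
    then have "a = 1" using False by (cases a) auto
    then show ?thesis using a by simp
  qed
qed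

lemma W_edge:
  assumes "i < g" "j < g" "x \<in> W i" "y \<in> W j" "(x, y) \<in> E"
  shows "j = Suc i mod g \<or> i = Suc j mod g"
proof (cases "i \<le> j")
  case True
  then show ?thesis using W_edge_forward[of i j x y] assms by auto
next
  case False
  then show ?thesis using W_edge_forward[of j i y x] assms E_sym by auto
qed

text \<open>The two neighbouring classes together have only \<open>d\<close> elements, so the minimum degree condition
  forces all edges to be present.\<close>

lemma W_nb:
  assumes i: "i < g" and x: "x \<in> W i"
  shows "nb x = W (i + 1) \<union> W (i + g - 1)"
proof (rule card_seteq)
  have fin: "finite (W i)" for i using finV by (simp add: W_def)
  then show "finite (W (i + 1) \<union> W (i + g - 1))" by simp
  show "nb x \<subseteq> W (i + 1) \<union> W (i + g - 1)"
  proof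
    fix y assume "y \<in> nb x"
    then have y: "(x, y) \<in> E" "y \<in> V" using nb_sub by (auto simp: nb_def)
    then obtain j where j: "j < g" "y \<in> W j" using W_cover by blast
    then have "j = (i + 1) mod g \<or> j = (i + g - 1) mod g"
      using W_edge[OF i j(1) x j(2) y(1)] eq_Suc_mod_iff[OF i j(1)] by simp
    then show "y \<in> W (i + 1) \<union> W (i + g - 1)"
      using j W_mod[of "i + 1"] W_mod[of "i + g - 1"] by auto
  qed
  have "card (W (i + 1) \<union> W (i + g - 1)) \<le> card (W (i + 1)) + card (W (i + g - 1))"
    by (rule card_Un_le)
  also have "\<dots> = d" using W_size[of "i + 1"] W_size[of "i + g - 1"] by simp
  also have "\<dots> \<le> card (nb x)" using deg x by (auto simp: W_def)
  finally show "card (W (i + 1) \<union> W (i + g - 1)) \<le> card (nb x)" .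
qed

lemma W_edge_iff:
  assumes "i < g" "j < g" "x \<in> W i" "y \<in> W j"
  shows "(x, y) \<in> E \<longleftrightarrow> j = Suc i mod g \<or> i = Suc j mod g"
proof
  assume "j = Suc i mod g \<or> i = Suc j mod g"
  then have "j = (i + 1) mod g \<or> j = (i + g - 1) mod g"
    using eq_Suc_mod_iff[OF assms(1,2)] by simp
  then have "y \<in> W (i + 1) \<union> W (i + g - 1)"
    using assms(4) W_mod[of "i + 1"] W_mod[of "i + g - 1"] by auto
  then show "(x, y) \<in> E" using W_nb[OF assms(1,3)] by (auto simp: nb_def)
qed (rule W_edge[OF assms])

end

section \<open>Small odd girth: almost disjoint pieces\<close>

locale dense_short_odd_girth = shortest_odd_walk +
  fixes k m d :: nat
  assumes g_eq: "g = 2 * m + 1"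
    and m_less: "m < k"
    and no_cyc: "\<not> cyc (2 * k + 1)"
    and deg: "v \<in> V \<Longrightarrow> d \<le> card (nb v)"
    and dense: "2 * card V \<le> (2 * k + 3) * d"
    and large: "1000 * k ^ 5 \<le> card V"
begin

text \<open>The number of common neighbours that makes a pair flexible. Since $d \ge n/(2k)$, a set of
  $20k^2$ vertices sends at least $10kn$ edges into the graph, whereas the greedy path construction
  needs somewhat more than $7k$ edges per vertex: up to $5k+1$ forbidden vertices and $2k$ for the path itself.\<close>

abbreviation K :: nat where
  "K \<equiv> 20 * k\<^sup>2"

text \<open>In the extremal graph, \<open>P i\<close> is the side of the \<open>i\<close>-th complete bipartite graph that
  contains the selected vertex \<open>c i\<close>, and \<open>Q i\<close> is the other side.\<close>

definition P :: "nat \<Rightarrow> 'a set" where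
  "P i = {v \<in> V. K \<le> card (nb v \<inter> nb (c i))}"

definition Q :: "nat \<Rightarrow> 'a set" where
  "Q i = {v \<in> V. K \<le> card (nb v \<inter> P i)}"

lemma m_pos: "1 \<le> m" and k_ge2: "2 \<le> k"
  using g_ge3 g_eq m_less by auto

lemma card_C: "card C = g" and fin_C: "finite C" and g_le: "g \<le> 2 * k - 1"
proof -
  show "card C = g" using c_inj by (simp add: C_def card_image)
  show "finite C" by (simp add: C_def)
  show "g \<le> 2 * k - 1" using g_eq m_less by simp
qed

lemma c_in_C: "i < g \<Longrightarrow> c i \<in> C"
  by (auto simp: C_def)

lemma card_V_le: "card V \<le> 2 * k * d"
proof -
  have "2 * k + 3 \<le> 4 * k" using k_ge2 by simp
  then have "(2 * k + 3) * d \<le> (4 * k) * d" by (rule mult_right_mono) simp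
  also have "\<dots> = 2 * (2 * k * d)" by simp
  finally show ?thesis using dense by linarith
qed

lemma d_large: "500 * k ^ 4 \<le> d"
proof -
  have "(2 * k) * (500 * k ^ 4) = 1000 * k ^ 5" by (simp add: power_numeral_reduce)
  then have "(2 * k) * (500 * k ^ 4) \<le> (2 * k) * d" using large card_V_le by linarith
  then show ?thesis using k_ge2 by (simp only: nat_mult_le_cancel_disj)
qed

lemma flex_large_common:
  assumes "x \<noteq> y" "K \<le> card (nb x \<inter> nb y)" "1 \<le> s" "s \<le> k"
  shows "flex (5 * k + 1) x y (2 * s)"
proof (rule flex_even[OF deg _ assms])
  have k2: "4 \<le> k\<^sup>2" using k_ge2 power_mono[of 2 k 2] by simp
  have "k ^ 3 * 1 \<le> k ^ 3 * k\<^sup>2" using k2 by (intro mult_left_mono) auto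
  also have "\<dots> = k ^ 5" by (simp flip: power_add)
  finally have k3: "1000 * k ^ 3 \<le> card V" using large by simp
  have "k\<^sup>2 * 2 \<le> k\<^sup>2 * k" using k_ge2 by (intro mult_left_mono) auto
  then have k23: "2 * k\<^sup>2 \<le> k ^ 3" by (simp add: power_numeral_reduce)
  have kV: "2 * card V \<le> k * card V" using k_ge2 by (intro mult_right_mono) auto
  have pos: "0 < k ^ 3" using k_ge2 by simp
  have "(7 * k + 3) * (K + card V) = 140 * k ^ 3 + 60 * k\<^sup>2 + 7 * (k * card V) + 3 * card V"
    by (simp add: algebra_simps power_numeral_reduce)
  also have "\<dots> < 10 * (k * card V)"
    using k3 k23 kV pos by linarith
  also have "10 * (k * card V) \<le> 10 * (k * (2 * k * d))"
    using card_V_le by (intro mult_left_mono) auto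
  also have "\<dots> = K * d" by (simp add: power2_eq_square)
  finally have "(7 * k + 3) * (K + card V) < K * d" .
  moreover have "5 * k + 1 + 2 * k + 2 = 7 * k + 3" by simp
  ultimately show "(5 * k + 1 + 2 * k + 2) * (K + card V) < K * d" by metis
qed

lemma arc_of_parity:
  assumes "i < g" "j < g" "i \<noteq> j"
  obtains q a where "path (c j) q (c i)" "length q = Suc a" "even a = b" "1 \<le> a" "a \<le> 2 * m" "set q \<subseteq> C"
proof -
  have *: "\<exists>q a. path (c j) q (c i) \<and> length q = Suc a \<and> even a = b \<and> 1 \<le> a \<and> a \<le> 2 * m \<and> set q \<subseteq> C"
    if ij: "i < j" "j < g" for i j
  proof (cases "even (j - i) = b")
    case True
    have "j < i + g" using ij by simp
    note fw = forward_arc[OF less_imp_le[OF ij(1)] this]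
    show ?thesis using path_rev[OF fw(1)] fw(2,3) ij True g_eq
      by (intro exI[of _ "rev (map c [i..<Suc j])"] exI[of _ "j - i"]) (auto simp del: upt_Suc)
  next
    case False
    have le: "j \<le> i + g" "i + g < j + g" using ij by auto
    note fw = forward_arc[OF le]
    have "path (c j) (map c [j..<Suc (i + g)]) (c i)" using fw(1) c_period by simp
    moreover have "even (i + g - j) = b"
    proof -
      have "i + g - j = g - (j - i)" using ij by simp
      then show ?thesis using False ij odd_g by auto
    qed
    ultimately show ?thesis using fw(2,3) ij g_eq
      by (intro exI[of _ "map c [j..<Suc (i + g)]"] exI[of _ "i + g - j"]) (auto simp del: upt_Suc)
  qed
  show ?thesis
  proof (cases "i < j")
    case True
    from *[OF this assms(2)] show ?thesis using that by blast
  next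
    case False
    then have "j < i" using assms by simp
    from *[OF this assms(1)] obtain q a where q: "path (c i) q (c j)" "length q = Suc a" "even a = b"
      "1 \<le> a" "a \<le> 2 * m" "set q \<subseteq> C" by blast
    show ?thesis using that[OF path_rev[OF q(1)]] q by auto
  qed
qed

text \<open>The cycle offers arcs of both parities, of lengths between 1 and \<open>2 * m\<close>. A path of the
  complementary length outside the cycle closes the arc to a cycle of length \<open>2 * k + 1\<close>.
  The length that is needed depends on \<open>i\<close> and \<open>j\<close>, so links of all lengths of one parity in
  the range are assumed.\<close>

lemma no_free_links:
  assumes ij: "i < g" "j < g" "i \<noteq> j"
    and link: "\<And>L. 2 * (k - m) + 1 \<le> L \<Longrightarrow> L \<le> 2 * k \<Longrightarrow> even L = b \<Longrightarrow>
      \<exists>p. path (c i) p (c j) \<and> length p = Suc L \<and> set p \<inter> (C - {c i, c j}) = {}"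
  shows False
proof -
  obtain q a where q: "path (c j) q (c i)" "length q = Suc a" "even a = (\<not> b)" "1 \<le> a" "a \<le> 2 * m"
    "set q \<subseteq> C"
    using arc_of_parity[OF ij] .
  have "even (2 * k + 1 - a) = b" using q m_less by auto
  moreover have "2 * (k - m) + 1 \<le> 2 * k + 1 - a" "2 * k + 1 - a \<le> 2 * k"
    using q m_less by arith+
  ultimately obtain p where p: "path (c i) p (c j)" "length p = Suc (2 * k + 1 - a)"
    "set p \<inter> (C - {c i, c j}) = {}"
    using link by blast
  have "set p \<inter> set q = {c i, c j}"
    using p q path_ends_in[OF p(1)] path_ends_in[OF q(1)] by auto
  moreover have "c i \<noteq> c j" using ij by (simp add: c_eq_iff)
  ultimately have "cyc (2 * k + 1 - a + a)"
    using cyc_of_two_paths[OF p(1) q(1)] p q by blast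
  then show False using no_cyc q m_less by simp
qed

lemma card_C_minus: "card (C - S) \<le> 2 * k" "finite (C - S)"
  using card_C g_le fin_C card_mono[of C "C - S"] by auto

lemma common_nb_small:
  assumes "i < g" "j < g" "i \<noteq> j"
  shows "card (nb (c i) \<inter> nb (c j)) < K"
proof (rule ccontr)
  assume "\<not> ?thesis"
  then have K: "K \<le> card (nb (c i) \<inter> nb (c j))" by simp
  have ne: "c i \<noteq> c j" using assms by (simp add: c_eq_iff)
  show False
  proof (rule no_free_links[OF assms, where b = True])
    fix L assume L: "2 * (k - m) + 1 \<le> L" "L \<le> 2 * k" "even L = True"
    have "flex (5 * k + 1) (c i) (c j) (2 * (L div 2))"
      by (rule flex_large_common[OF ne K]) (use L m_less in auto)
    then have "flex (5 * k + 1) (c i) (c j) L" using L by simp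
    then show "\<exists>p. path (c i) p (c j) \<and> length p = Suc L \<and> set p \<inter> (C - {c i, c j}) = {}"
      using flexD[of "5 * k + 1" "c i" "c j" L "C - {c i, c j}"] card_C_minus[of "{c i, c j}"]
      by fastforce
  qed
qed

lemma K_ge_80: "80 \<le> K"
proof -
  have "4 \<le> k\<^sup>2" using k_ge2 power_mono[of 2 k 2] by simp
  then show ?thesis by simp
qed

lemma c_in_P: "i < g \<Longrightarrow> c i \<in> P i"
proof -
  have "k\<^sup>2 * 1 \<le> k\<^sup>2 * k\<^sup>2" using k_ge2 by (intro mult_left_mono) auto
  then have "K \<le> 500 * k ^ 4" by (simp add: power_numeral_reduce)
  then show ?thesis using deg[OF c_in_V, of i] d_large c_in_V by (simp add: P_def)
qed

lemma c_in_P_iff: "i < g \<Longrightarrow> j < g \<Longrightarrow> c j \<in> P i \<longleftrightarrow> i = j"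
  using c_in_P common_nb_small[of j i] by (cases "i = j") (auto simp: P_def)

lemma P_inter_C: "i < g \<Longrightarrow> y \<in> P i \<Longrightarrow> y \<in> C \<Longrightarrow> y = c i"
  using c_in_P_iff by (auto simp: C_def)

lemma flex_P:
  assumes "i < g" "y \<in> P i" "y \<noteq> c i" "even L" "2 \<le> L" "L \<le> 2 * k"
  shows "flex (5 * k + 1) y (c i) L"
proof -
  have "flex (5 * k + 1) y (c i) (2 * (L div 2))"
    by (rule flex_large_common) (use assms in \<open>auto simp: P_def\<close>)
  then show ?thesis using assms by simp
qed

text \<open>A common element would link \<open>c i\<close> to \<open>c j\<close> by paths of all even lengths from 4 on. This just
  suffices, since even links start at length \<open>2 * (k - m) + 2\<close>.\<close>

lemma P_disjoint:
  assumes "i < g" "j < g" "i \<noteq> j" shows "P i \<inter> P j = {}"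
proof (rule ccontr)
  assume "\<not> ?thesis"
  then obtain y where y: "y \<in> P i" "y \<in> P j" by blast
  have ne: "c i \<noteq> c j" using assms by (simp add: c_eq_iff)
  have yC: "y \<notin> C" using P_inter_C y assms ne by metis
  then have yn: "y \<noteq> c i" "y \<noteq> c j" using assms by (auto simp: C_def)
  show False
  proof (rule no_free_links[OF assms, where b = True])
    fix L assume L: "2 * (k - m) + 1 \<le> L" "L \<le> 2 * k" "even L = True"
    have L4: "4 \<le> L" using L m_less by presburger
    have f1: "flex (5 * k + 1) (c i) y 2"
      by (rule flex_sym, rule flex_P) (use assms y yn k_ge2 in auto)
    have f2: "flex (5 * k + 1) y (c j) (L - 2)"
      by (rule flex_P) (use assms y yn L L4 in auto)
    have "card (C - {c i, c j}) + 2 + 1 \<le> 5 * k + 1" using card_C_minus[of "{c i, c j}"] k_ge2 by simp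
    then obtain p where "path (c i) p (c j)" "length p = Suc (2 + (L - 2))" "set p \<inter> (C - {c i, c j}) = {}"
      using flex_join[OF f1 f2, of "C - {c i, c j}"] fin_C yC yn ne by auto
    then show "\<exists>p. path (c i) p (c j) \<and> length p = Suc L \<and> set p \<inter> (C - {c i, c j}) = {}"
      using L4 by auto
  qed
qed

lemma edge_then_flex:
  assumes "flex t v z L" "(u, v) \<in> E" "finite F" "Suc (card F) \<le> t" "u \<notin> F" "v \<notin> F" "z \<notin> F" "u \<noteq> z"
  obtains p where "path u p z" "length p = Suc (Suc L)" "set p \<inter> F = {}"
proof -
  have "u \<noteq> v" using assms E_irrefl by auto
  then obtain p where p: "path v p z" "length p = Suc L" "set p \<inter> insert u F = {}"
    using flexD[OF assms(1), of "insert u F"] assms by (auto simp: card_insert_if)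
  then show ?thesis using that[of "u # p"] path_Cons[OF p(1) assms(2)] assms by auto
qed

lemma no_edge_c_P:
  assumes "i < g" "j < g" "i \<noteq> j" "y \<in> P i" "y \<noteq> c i" shows "(c j, y) \<notin> E"
proof
  assume e: "(c j, y) \<in> E"
  have ne: "c j \<noteq> c i" using assms by (simp add: c_eq_iff)
  have yC: "y \<notin> C" using P_inter_C assms by metis
  show False
  proof (rule no_free_links[OF assms(2,1) assms(3)[symmetric], where b = False])
    fix L assume L: "2 * (k - m) + 1 \<le> L" "L \<le> 2 * k" "even L = False"
    have L3: "3 \<le> L" using L m_less by presburger
    have f: "flex (5 * k + 1) y (c i) (L - 1)"
      by (rule flex_P) (use assms L L3 in auto)
    obtain p where "path (c j) p (c i)" "length p = Suc (Suc (L - 1))" "set p \<inter> (C - {c j, c i}) = {}"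
      using edge_then_flex[OF f e, of "C - {c j, c i}"] card_C_minus[of "{c j, c i}"] yC ne k_ge2 by auto
    then show "\<exists>p. path (c j) p (c i) \<and> length p = Suc L \<and> set p \<inter> (C - {c j, c i}) = {}"
      using L3 by auto
  qed
qed

lemma no_edge_c_P_same:
  assumes "i < g" "y \<in> P i" shows "(c i, y) \<notin> E"
proof
  assume e: "(c i, y) \<in> E"
  then have ne: "y \<noteq> c i" using E_irrefl by auto
  have "flex (5 * k + 1) y (c i) (2 * k)"
    by (rule flex_P) (use assms ne k_ge2 in auto)
  then obtain p where "path y p (c i)" "length p = Suc (2 * k)"
    using flexD[of "5 * k + 1" y "c i" "2 * k" "{}"] by auto
  then have "cyc (2 * k + 1)" using e unfolding cyc_def by auto
  then show False using no_cyc by simp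
qed

lemma nb_c_inter_P:
  assumes "i < g" "j < g" shows "nb (c j) \<inter> P i \<subseteq> {c i}"
  using no_edge_c_P no_edge_c_P_same assms by (cases "i = j") (auto simp: nb_def)

text \<open>Count the edges from \<open>nb (c i)\<close>: a vertex of \<open>P i\<close> receives at most \<open>card (nb (c i))\<close>
  of them, any other vertex fewer than \<open>K\<close>.\<close>

lemma card_P:
  assumes "i < g" shows "d \<le> card (P i) + 2 * k * K"
proof -
  let ?D = "card (nb (c i))"
  have D: "d \<le> ?D" by (rule deg[OF c_in_V])
  have D0: "0 < ?D" using d_large D k_ge2 by (simp add: order_less_le_trans[of 0 "500 * k ^ 4"])
  have "?D * d = (\<Sum>x\<in>nb (c i). d)" by simp
  also have "\<dots> \<le> (\<Sum>x\<in>nb (c i). card (nb x))" using nb_sub by (intro sum_mono deg) blast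
  also have "\<dots> = (\<Sum>y\<in>V. card {x \<in> nb (c i). (y, x) \<in> E})"
    using sum_card_nb[OF fin_nb, of "\<lambda>x. x"] by simp
  also have "\<dots> \<le> (\<Sum>y\<in>V. (if y \<in> P i then ?D else 0) + K)"
  proof (rule sum_mono)
    fix y assume y: "y \<in> V"
    have "{x \<in> nb (c i). (y, x) \<in> E} = nb y \<inter> nb (c i)" by (auto simp: nb_def)
    moreover have "card (nb y \<inter> nb (c i)) \<le> ?D" using fin_nb by (intro card_mono) auto
    ultimately show "card {x \<in> nb (c i). (y, x) \<in> E} \<le> (if y \<in> P i then ?D else 0) + K"
      using y by (auto simp: P_def)
  qed
  also have "\<dots> = card (P i) * ?D + card V * K"
  proof -
    have "V \<inter> P i = P i" by (auto simp: P_def)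
    then show ?thesis using finV by (simp add: sum.distrib sum.If_cases)
  qed
  also have "card V * K \<le> 2 * k * d * K" using card_V_le by (rule mult_right_mono) simp
  also have "2 * k * d * K \<le> 2 * k * ?D * K" using D by simp
  finally have "?D * d \<le> ?D * (card (P i) + 2 * k * K)" by (simp add: algebra_simps)
  then show ?thesis using D0 by simp
qed

text \<open>The neighbourhoods of the cycle vertices, trimmed to be disjoint from each other and from the
  sets \<open>P j\<close>.\<close>

definition X :: "nat \<Rightarrow> 'a set" where
  "X i = nb (c i) - C - (\<Union>j\<in>{..<g} - {i}. nb (c j))"

lemma card_X:
  assumes "i < g" shows "d \<le> card (X i) + g + g * K"
proof -
  let ?O = "\<Union>j\<in>{..<g} - {i}. nb (c i) \<inter> nb (c j)"
  have fX: "finite (X i)" using fin_nb by (simp add: X_def)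
  have "nb (c i) \<subseteq> (X i \<union> C) \<union> ?O" by (auto simp: X_def)
  then have "card (nb (c i)) \<le> card ((X i \<union> C) \<union> ?O)"
    using fX fin_C fin_nb by (intro card_mono) auto
  also have "\<dots> \<le> card (X i) + card C + card ?O"
    using card_Un_le[of "X i \<union> C" ?O] card_Un_le[of "X i" C] by linarith
  also have "card ?O \<le> (\<Sum>j\<in>{..<g} - {i}. card (nb (c i) \<inter> nb (c j)))"
    by (rule card_UN_le) simp
  also have "\<dots> \<le> (\<Sum>j\<in>{..<g} - {i}. K)"
    using common_nb_small[of i] assms by (intro sum_mono less_imp_le) auto
  also have "\<dots> \<le> g * K" using assms by simp
  finally show ?thesis using deg[OF c_in_V, of i] card_C by simp
qed

text \<open>The error term collects, for each of the fewer than $2k$ indices, the $O(k^3)$ vertices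
  lost in \<open>card_X\<close> and \<open>card_P\<close>.\<close>

lemma count_pieces:
  shows "g * (2 * d) \<le> card (\<Union>i<g. X i \<union> P i) + 164 * k ^ 4"
proof -
  have fX: "finite (X i)" "finite (P i)" for i using fin_nb finV by (auto simp: X_def P_def)
  have XP: "X i \<inter> P j = {}" if "i < g" "j < g" for i j
    using nb_c_inter_P[OF that(2,1)] that(2) c_in_C by (auto simp: X_def)
  have XX: "X i \<inter> X j = {}" if "i < g" "j < g" "i \<noteq> j" for i j
    using that by (auto simp: X_def)
  have "card (\<Union>i<g. X i \<union> P i) = (\<Sum>i<g. card (X i \<union> P i))"
  proof (rule card_UN_disjoint)
    show "\<forall>i\<in>{..<g}. finite (X i \<union> P i)" using fX by blast
    show "\<forall>i\<in>{..<g}. \<forall>j\<in>{..<g}. i \<noteq> j \<longrightarrow> (X i \<union> P i) \<inter> (X j \<union> P j) = {}"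
    proof (intro ballI impI)
      fix i j assume "i \<in> {..<g}" "j \<in> {..<g}" "i \<noteq> j"
      then have "X i \<inter> X j = {}" "X i \<inter> P j = {}" "X j \<inter> P i = {}" "P i \<inter> P j = {}"
        using XP[of i j] XP[of j i] XX P_disjoint by auto
      then show "(X i \<union> P i) \<inter> (X j \<union> P j) = {}" by blast
    qed
  qed simp
  also have "\<dots> = (\<Sum>i<g. card (X i) + card (P i))"
    using XP fX by (intro sum.cong card_Un_disjoint) auto
  finally have U: "card (\<Union>i<g. X i \<union> P i) = (\<Sum>i<g. card (X i) + card (P i))" .
  have "g * (2 * d) = (\<Sum>i<g. 2 * d)" by simp
  also have "\<dots> \<le> (\<Sum>i<g. card (X i) + card (P i) + (g + g * K + 2 * k * K))"
  proof (rule sum_mono)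
    fix i assume "i \<in> {..<g}"
    then show "2 * d \<le> card (X i) + card (P i) + (g + g * K + 2 * k * K)"
      using card_X[of i] card_P[of i] by simp
  qed
  also have "\<dots> = card (\<Union>i<g. X i \<union> P i) + g * (g + g * K + 2 * k * K)"
    using U by (simp add: sum.distrib)
  also have "g * (g + g * K + 2 * k * K) \<le> 2 * k * (2 * k + 2 * k * K + 2 * k * K)"
    using g_le by (intro mult_mono add_mono) auto
  also have "\<dots> = 4 * k\<^sup>2 + 160 * k ^ 4" by (simp add: algebra_simps power_numeral_reduce)
  also have "\<dots> \<le> 164 * k ^ 4"
  proof -
    have "k\<^sup>2 * 1 \<le> k\<^sup>2 * k\<^sup>2" using k_ge2 by (intro mult_left_mono) auto
    then show ?thesis by (simp add: power_numeral_reduce)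
  qed
  finally show ?thesis by simp
qed

text \<open>The count gives $4gd \le 2n + O(k^4)$ and the degree condition gives $2n \le (2k+3)d$. As $d$
  exceeds the error term, $4g < 2k+4$.\<close>

lemma short_girth_le: "4 * g \<le> 2 * k + 3"
proof (rule ccontr)
  assume "\<not> ?thesis"
  then have "2 * k + 4 \<le> 4 * g" by simp
  then have "(2 * k + 4) * d \<le> 4 * g * d" by (rule mult_right_mono) simp
  then have "2 * card V + d \<le> 4 * g * d" using dense by (simp add: algebra_simps)
  moreover have "(\<Union>i<g. X i \<union> P i) \<subseteq> V" using nb_sub by (auto simp: X_def P_def)
  then have "card (\<Union>i<g. X i \<union> P i) \<le> card V" using finV card_mono by blast
  then have "4 * g * d \<le> 2 * card V + 328 * k ^ 4" using count_pieces by simp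
  ultimately have "d \<le> 328 * k ^ 4" by simp
  moreover have "0 < k ^ 4" using k_ge2 by simp
  ultimately show False using d_large by linarith
qed

end

section \<open>Small odd girth: exact structure\<close>

locale extremal_short_odd_girth = dense_short_odd_girth +
  assumes half: "card V \<le> 2 * g * d"
begin

text \<open>Uniform description of how the vertices of a piece other than \<open>c i\<close> are joined to \<open>c i\<close>, with
  \<open>b\<close> telling whether the length is even. The common lower bound 3 on the length serves
  both sides of the piece, since \<open>k\<close> is now known to be large compared with \<open>m\<close>.\<close>

definition attached :: "nat \<Rightarrow> bool \<Rightarrow> 'a \<Rightarrow> bool" where
  "attached i b v \<longleftrightarrow> v \<notin> C \<and> (\<forall>L. 3 \<le> L \<longrightarrow> L \<le> 2 * k \<longrightarrow> even L = b \<longrightarrow> flex (5 * k) v (c i) L)"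

lemma k_large: "4 * m + 1 \<le> k" "5 \<le> k"
  using short_girth_le g_eq m_pos by auto

lemma flex_mono: "flex t x y L \<Longrightarrow> t' \<le> t \<Longrightarrow> flex t' x y L"
  by (auto simp: flex_def)

lemma attached_P:
  assumes "i < g" "v \<in> P i" "v \<noteq> c i" shows "attached i True v"
  using flex_mono[OF flex_P[OF assms]] P_inter_C assms by (auto simp: attached_def)

lemma Q_inter_C: "i < g \<Longrightarrow> Q i \<inter> C = {}"
proof (rule ccontr)
  assume i: "i < g" and "Q i \<inter> C \<noteq> {}"
  then obtain j where j: "j < g" "c j \<in> Q i" by (auto simp: C_def)
  have "card (nb (c j) \<inter> P i) \<le> card {c i}" using nb_c_inter_P[OF i j(1)] by (intro card_mono) auto
  then show False using j K_ge_80 by (simp add: Q_def)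
qed

text \<open>Step to one of the many neighbours in \<open>P i\<close> that avoid \<open>F\<close>; the vertex itself joins
  the forbidden set, which is why one more vertex was allowed for \<open>P i\<close>.\<close>

lemma attached_Q:
  assumes i: "i < g" and v: "v \<in> Q i" shows "attached i False v"
  unfolding attached_def
proof (intro conjI allI impI)
  show vC: "v \<notin> C" using Q_inter_C assms by blast
  fix L assume L: "3 \<le> L" "L \<le> 2 * k" "even L = False"
  show "flex (5 * k) v (c i) L"
    unfolding flex_def
  proof (intro allI impI)
    fix F assume F: "finite F \<and> card F \<le> 5 * k \<and> v \<notin> F \<and> c i \<notin> F"
    have "k * 2 \<le> k * k" using k_ge2 by (intro mult_left_mono) auto
    then have "5 * k + 2 \<le> K" unfolding power2_eq_square using k_ge2 by linarith
    moreover have "card (insert (c i) F) \<le> 5 * k + 1" using F by (simp add: card_insert_if)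
    ultimately have "\<not> nb v \<inter> P i \<subseteq> insert (c i) F"
      using v F card_mono[of "insert (c i) F" "nb v \<inter> P i"] by (auto simp: Q_def)
    then obtain y where y: "(v, y) \<in> E" "y \<in> P i" "y \<noteq> c i" "y \<notin> F" by (auto simp: nb_def)
    have "even (L - 1)" "2 \<le> L - 1" "L - 1 \<le> 2 * k" using L by auto
    from flex_P[OF i y(2,3) this]
    have "flex (5 * k + 1) y (c i) (L - 1)" .
    moreover have "v \<noteq> c i" using vC c_in_C i by auto
    ultimately obtain p where "path v p (c i)" "length p = Suc (Suc (L - 1))" "set p \<inter> F = {}"
      using edge_then_flex[OF _ y(1), of "5 * k + 1" "c i" "L - 1" F] F y by auto
    then show "\<exists>p. path v p (c i) \<and> length p = Suc L \<and> set p \<inter> F = {}" using L by auto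
  qed
qed

text \<open>The edge closes a path \<open>u \<dots> c i \<dots> v\<close> of even length \<open>2 * k\<close>.\<close>

lemma no_edge_same_side:
  assumes i: "i < g" and uv: "attached i b u" "attached i b v" shows "(u, v) \<notin> E"
proof
  assume e: "(u, v) \<in> E"
  \<comment> \<open>The shortest available length of the right parity; the second path takes up the rest.\<close>
  define L1 :: nat where "L1 = (if b then 4 else 3)"
  have L1: "3 \<le> L1" "L1 \<le> 4" "even L1 = b" by (auto simp: L1_def)
  have L2: "3 \<le> 2 * k - L1" "2 * k - L1 \<le> 2 * k" "even (2 * k - L1) = b" using L1 k_large by auto
  have f1: "flex (5 * k) u (c i) L1" using uv L1 k_large by (auto simp: attached_def)
  have f2: "flex (5 * k) (c i) v (2 * k - L1)" using uv L2 flex_sym by (auto simp: attached_def)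
  have "u \<noteq> v" using e E_irrefl by auto
  moreover have "c i \<noteq> v" using uv c_in_C i by (auto simp: attached_def)
  moreover have "L1 + 1 \<le> 5 * k" using L1 k_large by auto
  ultimately obtain p where "path u p v" "length p = Suc (L1 + (2 * k - L1))"
    using flex_join[OF f1 f2, of "{}"] by auto
  then have "cyc (Suc (L1 + (2 * k - L1)))" using E_sym[OF e] unfolding cyc_def by blast
  then show False using no_cyc L1 k_large by simp
qed

text \<open>The edge links \<open>c i\<close> to \<open>c j\<close> through \<open>u\<close> and \<open>v\<close>, by paths of all lengths of one parity from
  9 on, and \<open>2 * (k - m) + 1\<close> is at least 9.\<close>

lemma no_edge_across:
  assumes ij: "i < g" "j < g" "i \<noteq> j" and uv: "attached i b u" "attached j b' v"
  shows "(u, v) \<notin> E"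
proof
  assume e: "(u, v) \<in> E"
  \<comment> \<open>The shortest available length of the right parity; the second path takes up the rest.\<close>
  define L1 :: nat where "L1 = (if b then 4 else 3)"
  have L1: "3 \<le> L1" "L1 \<le> 4" "even L1 = b" by (auto simp: L1_def)
  have ne: "c i \<noteq> c j" using ij by (simp add: c_eq_iff)
  have uvC: "u \<notin> C" "v \<notin> C" using uv by (auto simp: attached_def)
  then have uvc: "c i \<noteq> v" "u \<noteq> c j" using ij c_in_C by auto
  show False
  proof (rule no_free_links[OF ij, where b = "b \<noteq> b'"])
    fix L assume L: "2 * (k - m) + 1 \<le> L" "L \<le> 2 * k" "even L = (b \<noteq> b')"
    have L9: "9 \<le> L" using L k_large m_pos by arith
    have "even (L - 1 - L1) = b'" using L L1 L9 by auto
    then have f2: "flex (5 * k) v (c j) (L - 1 - L1)" using uv L L9 L1 by (auto simp: attached_def)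
    have f1: "flex (5 * k) (c i) u L1" using flex_sym uv L1 k_large by (auto simp: attached_def)
    have "card (C - {c i, c j}) + L1 + 2 \<le> 5 * k" using card_C_minus[of "{c i, c j}"] L1 k_large by simp
    then obtain p where "path (c i) p (c j)" "length p = Suc (L1 + 1 + (L - 1 - L1))"
      "set p \<inter> (C - {c i, c j}) = {}"
      using flex_edge_join[OF f1 e f2, of "C - {c i, c j}"] fin_C uvC uvc ne by auto
    moreover have "L1 + 1 + (L - 1 - L1) = L" using L9 L1 by simp
    ultimately show "\<exists>p. path (c i) p (c j) \<and> length p = Suc L \<and> set p \<inter> (C - {c i, c j}) = {}"
      by metis
  qed
qed

lemma no_edge_c_attached:
  assumes ij: "i < g" "j < g" "i \<noteq> j" and v: "attached j b v"
  shows "(c i, v) \<notin> E"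
proof
  assume e: "(c i, v) \<in> E"
  have ne: "c i \<noteq> c j" using ij by (simp add: c_eq_iff)
  have vC: "v \<notin> C" using v by (auto simp: attached_def)
  show False
  proof (rule no_free_links[OF ij, where b = "\<not> b"])
    fix L assume L: "2 * (k - m) + 1 \<le> L" "L \<le> 2 * k" "even L = (\<not> b)"
    have L9: "9 \<le> L" using L k_large m_pos by arith
    have "even (L - 1) = b" using L L9 by auto
    then have f: "flex (5 * k) v (c j) (L - 1)" using v L L9 by (auto simp: attached_def)
    have "Suc (card (C - {c i, c j})) \<le> 5 * k" using card_C_minus[of "{c i, c j}"] k_large by simp
    then obtain p where "path (c i) p (c j)" "length p = Suc (Suc (L - 1))"
      "set p \<inter> (C - {c i, c j}) = {}"
      using edge_then_flex[OF f e, of "C - {c i, c j}"] fin_C vC ne by auto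
    moreover have "Suc (L - 1) = L" using L9 by simp
    ultimately show "\<exists>p. path (c i) p (c j) \<and> length p = Suc L \<and> set p \<inter> (C - {c i, c j}) = {}"
      by metis
  qed
qed

text \<open>Otherwise the vertex would have fewer than \<open>K\<close> neighbours in each set \<open>X i\<close> and \<open>P i\<close>,
  and only $O(k^4)$ vertices lie outside all of them: altogether fewer than $d$ neighbours.\<close>

lemma exhaust_pieces:
  assumes v: "v \<in> V" obtains i where "i < g" "v \<in> P i" | i where "i < g" "v \<in> Q i"
proof (rule ccontr)
  assume neg: "\<not> thesis"
  note obtain_P = that(1) and obtain_Q = that(2)
  let ?U = "\<Union>i<g. X i \<union> P i"
  have small: "card (nb v \<inter> (X i \<union> P i)) \<le> 2 * K" if "i < g" for i
  proof -
    have "v \<notin> P i" "v \<notin> Q i" using neg that obtain_P obtain_Q by blast+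
    then have "card (nb v \<inter> nb (c i)) < K" "card (nb v \<inter> P i) < K"
      using v by (auto simp: P_def Q_def)
    moreover have "card (nb v \<inter> (X i \<union> P i)) \<le> card ((nb v \<inter> nb (c i)) \<union> (nb v \<inter> P i))"
      using fin_nb by (intro card_mono) (auto simp: X_def)
    moreover have "\<dots> \<le> card (nb v \<inter> nb (c i)) + card (nb v \<inter> P i)" by (rule card_Un_le)
    ultimately show ?thesis by linarith
  qed
  have sub: "?U \<subseteq> V" using nb_sub by (auto simp: X_def P_def)
  have "card (V - ?U) = card V - card ?U" using sub finV by (meson card_Diff_subset finite_subset)
  then have left: "card (V - ?U) \<le> 164 * k ^ 4" using count_pieces half by simp
  have "nb v \<subseteq> (V - ?U) \<union> (\<Union>i<g. nb v \<inter> (X i \<union> P i))" using nb_sub by auto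
  then have "card (nb v) \<le> card ((V - ?U) \<union> (\<Union>i<g. nb v \<inter> (X i \<union> P i)))"
    using finV fin_nb by (intro card_mono) auto
  also have "\<dots> \<le> card (V - ?U) + card (\<Union>i<g. nb v \<inter> (X i \<union> P i))" by (rule card_Un_le)
  also have "card (\<Union>i<g. nb v \<inter> (X i \<union> P i)) \<le> (\<Sum>i<g. card (nb v \<inter> (X i \<union> P i)))"
    by (rule card_UN_le) simp
  also have "\<dots> \<le> (\<Sum>i<g. 2 * K)" using small by (intro sum_mono) auto
  also have "\<dots> = g * (2 * K)" by simp
  also have "\<dots> \<le> 2 * k * (2 * K)" using g_le by (intro mult_right_mono) auto
  also have "\<dots> = 80 * k ^ 3" by (simp add: power_numeral_reduce)
  finally have "d \<le> 164 * k ^ 4 + 80 * k ^ 3" using left deg[OF v] by simp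
  moreover have "k ^ 3 * 1 \<le> k ^ 3 * k" using k_ge2 by (intro mult_left_mono) auto
  then have "k ^ 3 \<le> k ^ 4" by (simp add: power_numeral_reduce)
  moreover have "0 < k ^ 4" using k_ge2 by simp
  ultimately show False using d_large by linarith
qed

lemma nb_P:
  assumes i: "i < g" and v: "v \<in> P i" "v \<noteq> c i" shows "nb v \<subseteq> Q i"
proof
  fix y assume "y \<in> nb v"
  then have y: "(v, y) \<in> E" "y \<in> V" using nb_sub by (auto simp: nb_def)
  note att = attached_P[OF i v]
  from y(2) show "y \<in> Q i"
  proof (cases rule: exhaust_pieces)
    case (1 j)
    have "y \<noteq> c j"
      using no_edge_c_P[OF i 1(1) _ v] no_edge_c_P_same[OF i v(1)] E_sym[OF y(1)] by auto
    from attached_P[OF 1 this] show ?thesis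
      using no_edge_same_side[OF i att] no_edge_across[OF i 1(1) _ att] y(1) by (cases "i = j") auto
  next
    case (2 j)
    then show ?thesis
      using no_edge_across[OF i 2(1) _ att attached_Q[OF 2]] y(1) by (cases "i = j") auto
  qed
qed

lemma nb_Q:
  assumes i: "i < g" and v: "v \<in> Q i" shows "nb v \<subseteq> P i"
proof
  fix y assume "y \<in> nb v"
  then have y: "(v, y) \<in> E" "y \<in> V" using nb_sub by (auto simp: nb_def)
  note att = attached_Q[OF i v]
  from y(2) show "y \<in> P i"
  proof (cases rule: exhaust_pieces)
    case (1 j)
    show ?thesis
    proof (cases "i = j")
      case False
      then have "y \<noteq> c j" using no_edge_c_attached[OF 1(1) i _ att] E_sym[OF y(1)] by auto
      from no_edge_across[OF i 1(1) False att attached_P[OF 1 this]] y(1) show ?thesis by blast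
    qed (use 1 in simp)
  next
    case (2 j)
    then show ?thesis
      using no_edge_across[OF i 2(1) _ att attached_Q[OF 2]]
        no_edge_same_side[OF i att] attached_Q[OF 2] y(1) by (cases "i = j") auto
  qed
qed

lemma nb_c:
  assumes i: "i < g" shows "nb (c i) \<subseteq> Q i \<union> C"
proof
  fix y assume "y \<in> nb (c i)"
  then have y: "(c i, y) \<in> E" "y \<in> V" using nb_sub by (auto simp: nb_def)
  from y(2) show "y \<in> Q i \<union> C"
  proof (cases rule: exhaust_pieces)
    case (1 j)
    then have "y = c j"
      using no_edge_c_P[OF 1(1) i _ 1(2)] no_edge_c_P_same[OF 1] y(1) by (cases "i = j") auto
    then show ?thesis using c_in_C 1 by simp
  next
    case (2 j)
    then show ?thesis
      using no_edge_c_attached[OF i 2(1) _ attached_Q[OF 2]] y(1) by (cases "i = j") auto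
  qed
qed

lemma Q_obtain_nb:
  assumes i: "i < g" and v: "v \<in> Q i"
  obtains y where "(v, y) \<in> E" "y \<in> P i" "y \<noteq> c i"
proof -
  have "\<not> nb v \<inter> P i \<subseteq> {c i}"
    using v K_ge_80 card_mono[of "{c i}" "nb v \<inter> P i"] by (auto simp: Q_def)
  then show ?thesis using that by (auto simp: nb_def)
qed

text \<open>Disjointness reduces to the absence of edges: a vertex of \<open>Q j\<close> has a neighbour \<open>y\<close> in
  \<open>P j\<close>, and an edge from \<open>P i\<close> to \<open>P j\<close> outside the cycle is already excluded.\<close>

lemma P_Q_disjoint:
  assumes ij: "i < g" "j < g" shows "P i \<inter> Q j = {}"
proof (rule ccontr)
  assume "\<not> ?thesis"
  then obtain v where v: "v \<in> P i" "v \<in> Q j" by blast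
  obtain y where y: "(v, y) \<in> E" "y \<in> P j" "y \<noteq> c j" using Q_obtain_nb[OF ij(2) v(2)] .
  have "v \<noteq> c i" using v Q_inter_C ij c_in_C by blast
  from attached_P[OF ij(1) v(1) this] attached_P[OF ij(2) y(2,3)] show False
    using no_edge_same_side[OF ij(1)] no_edge_across[OF ij] y(1) by (cases "i = j") auto
qed

lemma Q_disjoint:
  assumes ij: "i < g" "j < g" "i \<noteq> j" shows "Q i \<inter> Q j = {}"
proof (rule ccontr)
  assume "\<not> ?thesis"
  then obtain v where v: "v \<in> Q i" "v \<in> Q j" by blast
  obtain y where y: "(v, y) \<in> E" "y \<in> P i" "y \<noteq> c i" using Q_obtain_nb[OF ij(1) v(1)] .
  from no_edge_across[OF ij attached_P[OF ij(1) y(2,3)] attached_Q[OF ij(2) v(2)]] E_sym[OF y(1)]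
  show False by blast
qed

lemma finite_PQ: "finite (P i)" "finite (Q i)"
  using finV by (auto simp: P_def Q_def)

lemma d_gt_g: "g < d"
proof -
  have "k * 1 \<le> k * k ^ 3" using k_ge2 by (intro mult_left_mono) auto
  then have "k \<le> k ^ 4" by (simp add: power_numeral_reduce)
  then show ?thesis using d_large g_le k_ge2 by linarith
qed

text \<open>Each side contains the whole neighbourhood of some vertex of the other side; on the side of
  \<open>P i\<close> this needs a vertex other than \<open>c i\<close>.\<close>

lemma card_PQ_ge:
  assumes i: "i < g" shows "d \<le> card (P i)" "d \<le> card (Q i)"
proof -
  have "\<not> nb (c i) \<subseteq> C"
    using card_mono[OF fin_C, of "nb (c i)"] card_C d_gt_g deg[OF c_in_V, of i] by auto
  then obtain w where w: "w \<in> Q i" using nb_c[OF i] by blast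
  then have "d \<le> card (nb w)" by (auto intro: deg simp: Q_def)
  also have "\<dots> \<le> card (P i)" using nb_Q[OF i w] finite_PQ by (intro card_mono)
  finally show P: "d \<le> card (P i)" .
  obtain v where v: "v \<in> P i" "v \<noteq> c i" using Q_obtain_nb[OF i w] by blast
  then have "d \<le> card (nb v)" by (auto intro: deg simp: P_def)
  also have "\<dots> \<le> card (Q i)" using nb_P[OF i v] finite_PQ by (intro card_mono)
  finally show "d \<le> card (Q i)" .
qed

lemma V_eq: "V = (\<Union>i<g. P i \<union> Q i)"
proof
  show "V \<subseteq> (\<Union>i<g. P i \<union> Q i)"
  proof
    fix v assume "v \<in> V"
    then show "v \<in> (\<Union>i<g. P i \<union> Q i)" by (cases rule: exhaust_pieces) auto
  qed
qed (auto simp: P_def Q_def)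

lemma card_V_sum: "card V = (\<Sum>i<g. card (P i) + card (Q i))"
proof -
  have "card V = card (\<Union>i<g. P i \<union> Q i)"
    by (rule arg_cong[OF V_eq])
  also have "\<dots> = (\<Sum>i<g. card (P i \<union> Q i))"
  proof (rule card_UN_disjoint)
    show "\<forall>i\<in>{..<g}. finite (P i \<union> Q i)" using finite_PQ by blast
    show "\<forall>i\<in>{..<g}. \<forall>j\<in>{..<g}. i \<noteq> j \<longrightarrow> (P i \<union> Q i) \<inter> (P j \<union> Q j) = {}"
    proof (intro ballI impI)
      fix i j assume "i \<in> {..<g}" "j \<in> {..<g}" "i \<noteq> j"
      then have "P i \<inter> P j = {}" "P i \<inter> Q j = {}" "P j \<inter> Q i = {}" "Q i \<inter> Q j = {}"
        using P_disjoint P_Q_disjoint[of i j] P_Q_disjoint[of j i] Q_disjoint by auto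
      then show "(P i \<union> Q i) \<inter> (P j \<union> Q j) = {}" by blast
    qed
  qed simp
  also have "\<dots> = (\<Sum>i<g. card (P i) + card (Q i))"
    using P_Q_disjoint finite_PQ by (intro sum.cong card_Un_disjoint) auto
  finally show ?thesis .
qed

text \<open>The lower bound is exact now, without error term, and meets the assumption \<open>half\<close>.\<close>

lemma card_V_eq: "card V = 2 * g * d"
proof (rule antisym[OF half])
  have "2 * g * d = (\<Sum>i<g. d + d)" by simp
  also have "\<dots> \<le> card V" unfolding card_V_sum using card_PQ_ge by (intro sum_mono add_mono) auto
  finally show "2 * g * d \<le> card V" .
qed

lemma card_PQ_eq:
  assumes "i < g" shows "card (P i) = d" "card (Q i) = d"
proof -
  have "card (P i) + card (Q i) = d + d"
  proof (rule ccontr)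
    assume "\<not> ?thesis"
    then have "d + d < card (P i) + card (Q i)" using card_PQ_ge[OF assms] by linarith
    then have "(\<Sum>i<g. d + d) < (\<Sum>i<g. card (P i) + card (Q i))"
      using card_PQ_ge assms by (intro sum_strict_mono_ex1) (auto intro!: add_mono)
    then show False using card_V_eq card_V_sum by simp
  qed
  then show "card (P i) = d" "card (Q i) = d" using card_PQ_ge[OF assms] by linarith+
qed

lemma nb_Q_eq:
  assumes i: "i < g" and v: "v \<in> Q i" shows "nb v = P i"
proof (rule card_seteq[OF finite_PQ(1) nb_Q[OF assms]])
  show "card (P i) \<le> card (nb v)" using card_PQ_eq(1)[OF i] deg v by (auto simp: Q_def)
qed

lemma edge_Q_iff:
  assumes "i < g" "v \<in> Q i" shows "(v, w) \<in> E \<longleftrightarrow> w \<in> P i"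
  using nb_Q_eq[OF assms] by (auto simp: nb_def)

lemma edge_P_P_iff:
  assumes ij: "i < g" "j < g" and uv: "u \<in> P i" "v \<in> P j"
  shows "(u, v) \<in> E \<longleftrightarrow> u = c i \<and> v = c j \<and> (j = Suc i mod g \<or> i = Suc j mod g)"
proof
  assume e: "(u, v) \<in> E"
  have "u = c i"
    using nb_P[OF ij(1) uv(1)] P_Q_disjoint[OF ij(2,1)] uv e by (auto simp: nb_def)
  moreover have "v = c j"
    using nb_P[OF ij(2) uv(2)] P_Q_disjoint[OF ij] uv E_sym[OF e] by (auto simp: nb_def)
  ultimately show "u = c i \<and> v = c j \<and> (j = Suc i mod g \<or> i = Suc j mod g)"
    using chord_iff[OF ij] e by simp
qed (use chord_iff[OF ij] in auto)

end

section \<open>Copies of cycles and isomorphisms\<close>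

lemma out_degree_eq: "out_degree (with_proj G) v = card {w. (v, w) \<in> parcs G}"
proof -
  have "out_arcs (with_proj G) v = Pair v ` {w. (v, w) \<in> parcs G}"
    by (auto simp: out_arcs_def)
  then show ?thesis by (simp add: out_degree_def card_image inj_on_def)
qed

lemma min_degree_eqI:
  assumes "finite (pverts G)" "\<And>v. v \<in> pverts G \<Longrightarrow> d \<le> card {w. (v, w) \<in> parcs G}"
    and "u \<in> pverts G" "card {w. (u, w) \<in> parcs G} = d"
  shows "min_degree G = d"
  unfolding min_degree_def out_degree_eq
  by (rule Min_eqI) (use assms in auto)

lemma pair_graphI:
  assumes "finite (pverts G)" "parcs G \<subseteq> pverts G \<times> pverts G"
    and "\<And>u v. (u, v) \<in> parcs G \<Longrightarrow> (v, u) \<in> parcs G" "\<And>v. (v, v) \<notin> parcs G"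
  shows "pair_graph G"
proof unfold_locales
  show "finite (parcs G)" using assms(1,2) by (meson finite_SigmaI finite_subset)
  show "symmetric (with_proj G)" using assms(3) by (auto simp: symmetric_def intro!: symI)
  fix e assume e: "e \<in> parcs G"
  show "fst e \<noteq> snd e"
  proof
    assume "fst e = snd e"
    then have "e = (snd e, snd e)" by (simp add: prod_eq_iff)
    then show False using e assms(4) by metis
  qed
qed (use assms in auto)

lemma pair_graph_imp_sgraph: "pair_graph G \<Longrightarrow> sgraph (pverts G) (parcs G)"
proof -
  assume "pair_graph G"
  then interpret pair_graph G .
  show ?thesis
    by unfold_locales
      (use pair_finite_verts in_arcsD1 in_arcsD2 arcs_symmetric pair_no_loops in fastforce)+
qed

lemma digraph_iso_image:
  assumes "pair_wf_digraph F" "inj_on f (pverts F)"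
  shows "digraph_iso (with_proj F) (with_proj \<lparr>pverts = f ` pverts F, parcs = map_prod f f ` parcs F\<rparr>)"
proof -
  interpret pair_wf_digraph F by fact
  let ?h = "\<lparr>iso_verts = f, iso_arcs = map_prod f f, iso_head = snd, iso_tail = fst\<rparr>"
  have "inj_on (map_prod f f) (parcs F)"
  proof (rule inj_onI)
    fix e e' assume e: "e \<in> parcs F" "e' \<in> parcs F" "map_prod f f e = map_prod f f e'"
    then have "f (fst e) = f (fst e')" "f (snd e) = f (snd e')"
      by (metis fst_map_prod, metis snd_map_prod)
    then show "e = e'"
      using e arc_fst_in_verts arc_snd_in_verts assms(2) by (metis inj_onD prod.expand)
  qed
  then have "pre_digraph.digraph_isomorphism (with_proj F) ?h"
    using assms wf_digraph_wp_iff by (auto simp: pre_digraph.digraph_isomorphism_def)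
  then show ?thesis
    unfolding digraph_iso_def by (intro exI[of _ ?h]) (simp add: app_iso_def with_proj_def)
qed

text \<open>Both extremal graphs have concrete vertices, so a parametrisation of \<open>G\<close> by them is easier to
  write down than a map out of \<open>G\<close>.\<close>

lemma digraph_iso_by_inverse:
  assumes wf: "pair_wf_digraph G" "pair_wf_digraph H"
    and bij: "bij_betw \<phi> (pverts H) (pverts G)"
    and adj: "\<And>x y. x \<in> pverts H \<Longrightarrow> y \<in> pverts H \<Longrightarrow> (\<phi> x, \<phi> y) \<in> parcs G \<longleftrightarrow> (x, y) \<in> parcs H"
  shows "digraph_iso (with_proj G) (with_proj H)"
proof -
  interpret G: pair_wf_digraph G by fact
  interpret H: pair_wf_digraph H by fact
  define f where "f = inv_into (pverts H) \<phi>"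
  have f: "bij_betw f (pverts G) (pverts H)" unfolding f_def by (rule bij_betw_inv_into[OF bij])
  have f\<phi>: "f (\<phi> x) = x" if "x \<in> pverts H" for x
    unfolding f_def using bij that by (meson bij_betw_inv_into_left)
  have \<phi>f: "\<phi> (f u) = u" if "u \<in> pverts G" for u
    unfolding f_def using bij that by (meson bij_betw_inv_into_right)
  have fin: "f u \<in> pverts H" if "u \<in> pverts G" for u using f that by (meson bij_betwE)
  have "map_prod f f ` parcs G = parcs H"
  proof
    show "map_prod f f ` parcs G \<subseteq> parcs H"
    proof
      fix e assume "e \<in> map_prod f f ` parcs G"
      then obtain u v where e: "e = (f u, f v)" "(u, v) \<in> parcs G" by auto
      then have "u \<in> pverts G" "v \<in> pverts G" using G.in_arcsD1 G.in_arcsD2 by auto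
      then show "e \<in> parcs H" using adj[of "f u" "f v"] fin \<phi>f e by simp
    qed
    show "parcs H \<subseteq> map_prod f f ` parcs G"
    proof
      fix e assume e: "e \<in> parcs H"
      obtain x y where xy: "e = (x, y)" by (cases e)
      then have in_H: "x \<in> pverts H" "y \<in> pverts H" using e H.in_arcsD1 H.in_arcsD2 by auto
      then have "(\<phi> x, \<phi> y) \<in> parcs G" using adj e xy by simp
      moreover have "map_prod f f (\<phi> x, \<phi> y) = e" using f\<phi> in_H xy by simp
      ultimately show "e \<in> map_prod f f ` parcs G" by (metis imageI)
    qed
  qed
  moreover have "f ` pverts G = pverts H" using f by (rule bij_betw_imp_surj_on)
  ultimately have "\<lparr>pverts = f ` pverts G, parcs = map_prod f f ` parcs G\<rparr> = H" by simp
  then show ?thesis using digraph_iso_image[OF wf(1) bij_betw_imp_inj_on[OF f]] by simp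
qed

lemma cycle_graph_simps [simp]:
  "pverts (cycle_graph m) = {..<m}"
  "(i, j) \<in> parcs (cycle_graph m) \<longleftrightarrow> i < m \<and> j < m \<and> (j = Suc i mod m \<or> i = Suc j mod m)"
  by (auto simp: cycle_graph_def)

lemma pair_wf_cycle_graph: "pair_wf_digraph (cycle_graph m)"
  by unfold_locales (auto simp: cycle_graph_def)

lemma cycle_graph_irrefl: "2 \<le> m \<Longrightarrow> (i, i) \<notin> parcs (cycle_graph m)"
  by (auto simp: mod_Suc)

lemma contains_copy_cycleI:
  assumes wf: "pair_wf_digraph G" and inj: "inj_on f {..<m}" and V: "f ` {..<m} \<subseteq> pverts G"
    and sym: "\<And>u v. (u, v) \<in> parcs G \<Longrightarrow> (v, u) \<in> parcs G"
    and step: "\<And>i. i < m \<Longrightarrow> (f i, f (Suc i mod m)) \<in> parcs G"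
  shows "contains_copy G (cycle_graph m)"
proof -
  let ?H = "\<lparr>pverts = f ` pverts (cycle_graph m), parcs = map_prod f f ` parcs (cycle_graph m)\<rparr>"
  have "pair_wf_digraph ?H"
    by unfold_locales auto
  moreover have "parcs ?H \<subseteq> parcs G"
    using step sym by auto
  ultimately have "subgraph (with_proj ?H) (with_proj G)"
    using V wf by (auto simp: subgraph_def wf_digraph_wp_iff compatible_def)
  then show ?thesis
    using digraph_iso_image[OF pair_wf_cycle_graph, of f m] inj unfolding contains_copy_def by auto
qed

lemma contains_copy_cycleD:
  assumes "contains_copy G (cycle_graph m)"
  obtains f where "inj_on f {..<m}" "\<And>i. i < m \<Longrightarrow> (f i, f (Suc i mod m)) \<in> parcs G"
proof -
  obtain h where h: "pre_digraph.digraph_isomorphism (with_proj (cycle_graph m)) h"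
    and sub: "subgraph (app_iso h (with_proj (cycle_graph m))) (with_proj G)"
    using assms by (auto simp: contains_copy_def digraph_iso_def)
  have "iso_tail h = fst" "iso_head h = snd"
    using sub by (auto simp: subgraph_def compatible_def)
  then have "iso_arcs h (i, j) = (iso_verts h i, iso_verts h j)" if "(i, j) \<in> parcs (cycle_graph m)" for i j
    using h that by (auto simp: pre_digraph.digraph_isomorphism_def prod_eq_iff simp del: cycle_graph_simps)
  moreover have "iso_arcs h e \<in> parcs G" if "e \<in> parcs (cycle_graph m)" for e
    using sub that by (auto simp: subgraph_def simp del: cycle_graph_simps)
  ultimately have "(iso_verts h i, iso_verts h j) \<in> parcs G" if "(i, j) \<in> parcs (cycle_graph m)" for i j
    using that by metis
  then have "(iso_verts h i, iso_verts h (Suc i mod m)) \<in> parcs G" if "i < m" for i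
    using that by simp
  moreover have "inj_on (iso_verts h) {..<m}"
    using h by (simp add: pre_digraph.digraph_isomorphism_def)
  ultimately show ?thesis using that by blast
qed

lemma (in sgraph) cyc_imp_copy:
  assumes "pair_graph G" "pverts G = V" "parcs G = E" "cyc m"
  shows "contains_copy G (cycle_graph m)"
proof -
  interpret G: pair_graph G by fact
  obtain x p y where p: "path x p y" "length p = m" "(y, x) \<in> E"
    using assms(4) by (auto simp: cyc_def)
  have ne: "p \<noteq> []" using p by (auto simp: path_def)
  have step: "(p ! i, p ! (Suc i mod m)) \<in> E" if "i < m" for i
  proof (cases "Suc i = m")
    case True
    then have "p ! i = y" "p ! 0 = x"
      using p ne by (auto simp: path_def last_conv_nth hd_conv_nth)
    then show ?thesis using True p by simp
  next
    case False
    then show ?thesis using that p by (auto simp: path_def successively_conv_nth)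
  qed
  show ?thesis
  proof (rule contains_copy_cycleI[where f = "(!) p"])
    show "inj_on ((!) p) {..<m}" using p by (auto simp: path_def inj_on_nth)
    show "(!) p ` {..<m} \<subseteq> pverts G" using step EV assms(2) by blast
  qed (use step assms G.arcs_symmetric in auto)
qed

text \<open>Lift the walk to the integers, where every step is $\pm 1$. After an odd number of steps the
  displacement is odd, hence nonzero, and it is divisible by \<open>r\<close>.\<close>

lemma odd_closed_walk_cycle_graph:
  fixes f :: "nat \<Rightarrow> nat"
  assumes r: "0 < r" and walk: "\<And>j. (f j, f (Suc j)) \<in> parcs (cycle_graph r)"
    and closed: "f L = f 0" and L: "odd L"
  shows "r \<le> L"
proof -
  define e :: "nat \<Rightarrow> int" where "e j = (if f (Suc j) = Suc (f j) mod r then 1 else -1)" for j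
  define H where "H j = (\<Sum>i<j. e i)" for j
  have lift: "(int (f 0) + H j) mod int r = int (f j)" for j
  proof (induction j)
    case 0
    then show ?case using walk[of 0] by (simp add: H_def)
  next
    case (Suc j)
    have "(int (f 0) + H (Suc j)) mod int r = ((int (f 0) + H j) mod int r + e j) mod int r"
      by (simp add: H_def mod_simps add.assoc)
    also have "\<dots> = (int (f j) + e j) mod int r" using Suc by simp
    also have "\<dots> = int (f (Suc j))"
    proof (cases "f (Suc j) = Suc (f j) mod r")
      case True
      then show ?thesis by (simp add: e_def zmod_int add.commute)
    next
      case False
      then have pred: "f j = Suc (f (Suc j)) mod r" using walk[of j] by auto
      have "(int (f j) - 1) mod int r = (int (Suc (f (Suc j))) - 1) mod int r"
        unfolding pred by (simp add: zmod_int mod_diff_left_eq)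
      then show ?thesis using False walk[of j] by (simp add: e_def)
    qed
    finally show ?case .
  qed
  have par: "even (H j) = even j" for j
    by (induction j) (auto simp: H_def e_def)
  have bound: "\<bar>H j\<bar> \<le> int j" for j
    by (induction j) (auto simp: H_def e_def)
  have "(int (f 0) + H L) mod int r = (int (f 0) + H 0) mod int r"
    using lift[of L] lift[of 0] closed by simp
  then have "int r dvd H L" by (simp add: mod_eq_dvd_iff H_def)
  moreover have "H L \<noteq> 0" using par[of L] L by auto
  ultimately have "int r \<le> \<bar>H L\<bar>" using dvd_imp_le_int by force
  then show ?thesis using bound[of L] by simp
qed

lemma not_bipartite_if_odd_closed_walk:
  fixes f :: "nat \<Rightarrow> 'a"
  assumes walk: "\<And>j. (f j, f (Suc j)) \<in> parcs G" and closed: "f L = f 0" and L: "odd L"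
  shows "\<not> bipartite G"
proof
  assume "bipartite G"
  then obtain U W where UW: "U \<inter> W = {}" "parcs G \<subseteq> U \<times> W \<union> W \<times> U"
    by (auto simp: bipartite_def)
  have "f (Suc j) \<in> U \<longleftrightarrow> f j \<notin> U" for j using walk[of j] UW by auto
  then have "f j \<in> U \<longleftrightarrow> (even j \<longleftrightarrow> f 0 \<in> U)" for j by (induction j) auto
  from this[of L] show False using closed L by auto
qed

section \<open>The extremal graphs\<close>

locale odd_cycle_family =
  fixes l k :: nat and \<C> :: "nat pair_pre_digraph set"
  assumes l_pos: "1 \<le> l" and l_less_k: "l < k"
    and odd: "\<C> \<subseteq> odd_cycles"
    and l_notin: "cycle_graph (2 * l + 1) \<notin> \<C>"
    and less_l_in: "\<And>i. 1 \<le> i \<Longrightarrow> i < l \<Longrightarrow> cycle_graph (2 * i + 1) \<in> \<C>"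
    and k_in: "cycle_graph (2 * k + 1) \<in> \<C>"
    and greater_k_notin: "\<And>i. k < i \<Longrightarrow> cycle_graph (2 * i + 1) \<notin> \<C>"

lemma blow_up_simps [simp]:
  "pverts (blow_up F t) = pverts F \<times> {..<t}"
  "((u, a), (v, b)) \<in> parcs (blow_up F t) \<longleftrightarrow> (u, v) \<in> parcs F \<and> a < t \<and> b < t"
  by (auto simp: blow_up_def)

lemma blow_up_arc_fst: "(x, y) \<in> parcs (blow_up F t) \<Longrightarrow> (fst x, fst y) \<in> parcs F"
  by (cases x; cases y) auto

lemma pair_graph_blow_up_cycle:
  assumes "2 \<le> r" shows "pair_graph (blow_up (cycle_graph r) t)"
proof (rule pair_graphI)
  show "(x, x) \<notin> parcs (blow_up (cycle_graph r) t)" for x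
    using blow_up_arc_fst[of x x] cycle_graph_irrefl[OF assms] by blast
qed auto

lemma card_cycle_graph_nbs:
  assumes "i < r" "3 \<le> r" shows "card {j. (i, j) \<in> parcs (cycle_graph r)} = 2"
proof -
  have "{j. (i, j) \<in> parcs (cycle_graph r)} = {Suc i mod r, (i + r - 1) mod r}"
    using eq_Suc_mod_iff[OF assms(1)] assms by auto
  moreover have "Suc i mod r \<noteq> (i + r - 1) mod r"
  proof
    assume "Suc i mod r = (i + r - 1) mod r"
    then have "(2 + i) mod r = (0 + i) mod r"
      using mod_add_right_cancel_nat[of "Suc i" 1 r "i + r - 1"] assms by simp
    then have "2 mod r = 0 mod r" by (simp only: mod_add_right_cancel_nat)
    then show False using assms by simp
  qed
  ultimately show ?thesis by simp
qed

lemma (in odd_cycle_family) blow_up_free_nonbipartite: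
  assumes t: "0 < t" "n = (2 * k + 3) * t"
  shows "free_nonbipartite \<C> n (real (2 * t)) (cycle_blow_up k n)"
proof -
  let ?r = "2 * k + 3"
  let ?G = "blow_up (cycle_graph ?r) t"
  have G: "cycle_blow_up k n = ?G" using t by (simp add: cycle_blow_up_def)
  have "\<not> contains_copy ?G F" if F: "F \<in> \<C>" for F
  proof
    assume "contains_copy ?G F"
    moreover obtain i where i: "F = cycle_graph (2 * i + 1)" using F odd by (auto simp: odd_cycles_def)
    ultimately obtain f where f: "\<And>j. j < 2 * i + 1 \<Longrightarrow> (f j, f (Suc j mod (2 * i + 1))) \<in> parcs ?G"
      using contains_copy_cycleD by metis
    have "?r \<le> 2 * i + 1"
    proof (rule odd_closed_walk_cycle_graph)
      fix j
      have "Suc (j mod (2 * i + 1)) mod (2 * i + 1) = Suc j mod (2 * i + 1)" by (simp add: mod_Suc_eq)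
      then show "(fst (f (j mod (2 * i + 1))), fst (f (Suc j mod (2 * i + 1)))) \<in> parcs (cycle_graph ?r)"
        using f[of "j mod (2 * i + 1)"] blow_up_arc_fst by (metis mod_less_divisor zero_less_Suc Suc_eq_plus1)
    qed auto
    then show False using greater_k_notin[of i] F i by simp
  qed
  then have free: "family_free \<C> ?G" by (simp add: family_free_def)
  have nonbip: "\<not> bipartite ?G"
  proof (rule not_bipartite_if_odd_closed_walk)
    show "((j mod ?r, 0), (Suc j mod ?r, 0)) \<in> parcs ?G" for j
      using t by (simp add: mod_Suc_eq del: mod_Suc)
    show "(?r mod ?r, 0) = (0 mod ?r, 0)" by simp
    show "odd ?r" by simp
  qed
  have deg: "card {y. (x, y) \<in> parcs ?G} = 2 * t" if x: "x \<in> pverts ?G" for x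
  proof -
    obtain i a where ia: "x = (i, a)" "i < ?r" "a < t" using x by auto
    then have "{y. (x, y) \<in> parcs ?G} = {j. (i, j) \<in> parcs (cycle_graph ?r)} \<times> {..<t}"
      by (auto simp del: cycle_graph_simps)
    then show ?thesis using card_cycle_graph_nbs[OF ia(2)] by (simp add: card_cartesian_product)
  qed
  have "min_degree ?G = 2 * t"
    by (rule min_degree_eqI[where u = "(0, 0)"]) (use t in \<open>auto intro: deg simp: deg\<close>)
  moreover have "pair_graph ?G" by (rule pair_graph_blow_up_cycle) simp
  moreover have "card (pverts ?G) = n" using t by (simp add: card_cartesian_product)
  ultimately show ?thesis unfolding free_nonbipartite_def G using free nonbip by simp
qed

lemma BC_simps:
  assumes "n = 2 * (2 * l + 1) * m"
  shows "pverts (BC l n) = {..<2 * l + 1} \<times> UNIV \<times> {..<m}"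
    and "((i, s, a), (j, t, b)) \<in> parcs (BC l n) \<longleftrightarrow>
      i = j \<and> i < 2 * l + 1 \<and> s \<noteq> t \<and> a < m \<and> b < m \<or>
      \<not> s \<and> \<not> t \<and> a = 0 \<and> b = 0 \<and> (i, j) \<in> parcs (cycle_graph (2 * l + 1))"
proof -
  have m: "n div (2 * (2 * l + 1)) = m"
    using assms by (metis nonzero_mult_div_cancel_left add_is_0 mult_is_0 one_neq_zero zero_neq_numeral)
  show "pverts (BC l n) = {..<2 * l + 1} \<times> UNIV \<times> {..<m}"
    unfolding BC_def Let_def m by simp
  show "((i, s, a), (j, t, b)) \<in> parcs (BC l n) \<longleftrightarrow>
      i = j \<and> i < 2 * l + 1 \<and> s \<noteq> t \<and> a < m \<and> b < m \<or>
      \<not> s \<and> \<not> t \<and> a = 0 \<and> b = 0 \<and> (i, j) \<in> parcs (cycle_graph (2 * l + 1))"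
    unfolding BC_def Let_def m by (auto simp del: cycle_graph_simps)
qed

lemma pair_graph_BC:
  assumes "1 \<le> l" "0 < m" "n = 2 * (2 * l + 1) * m"
  shows "pair_graph (BC l n)"
proof (rule pair_graphI)
  show "(x, x) \<notin> parcs (BC l n)" for x
    using cycle_graph_irrefl[of "2 * l + 1"] assms(1)
    by (cases x) (simp add: BC_simps[OF assms(3)] del: cycle_graph_simps)
  show "(x, y) \<in> parcs (BC l n) \<Longrightarrow> (y, x) \<in> parcs (BC l n)" for x y
    by (cases x; cases y) (auto simp: BC_simps[OF assms(3)])
  show "parcs (BC l n) \<subseteq> pverts (BC l n) \<times> pverts (BC l n)"
    using assms(2) by (auto simp: BC_simps[OF assms(3)])
qed (simp add: BC_simps[OF assms(3)])

text \<open>A cycle that leaves a complete bipartite piece can enter the next one only in its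
  selected vertex, and can leave it again only through that same vertex, which it visits only once;
  so it never uses any other vertex of a piece and is a cycle of the selected vertices. A cycle
  that stays in one piece is even.\<close>

lemma odd_cycle_in_BC:
  assumes l: "1 \<le> l" and n: "n = 2 * (2 * l + 1) * m" and L: "odd L"
    and inj: "inj_on f {..<L}"
    and step: "\<And>j. j < L \<Longrightarrow> (f j, f (Suc j mod L)) \<in> parcs (BC l n)"
  shows "L = 2 * l + 1"
proof -
  let ?r = "2 * l + 1"
  have L0: "0 < L" using L by (auto intro: gr0I)
  define h where "h j = f (j mod L)" for j
  have h_step: "(h j, h (Suc j)) \<in> parcs (BC l n)" for j
  proof -
    have "Suc (j mod L) mod L = Suc j mod L" by (simp add: mod_Suc_eq)
    then show ?thesis using step[of "j mod L"] L0 by (simp add: h_def)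
  qed
  have h_period: "h (j + L) = h j" for j by (simp add: h_def)
  have h_inj: "h i = h j \<Longrightarrow> i mod L = j mod L" for i j
    using inj L0 by (auto simp: h_def inj_on_def)
  have crossing: "\<exists>i j. h t = (i, False, 0) \<and> h (Suc t) = (j, False, 0) \<and> (i, j) \<in> parcs (cycle_graph ?r)"
    if "fst (h t) \<noteq> fst (h (Suc t))" for t
    using h_step[of t] that
    by (cases "h t"; cases "h (Suc t)") (auto simp: BC_simps[OF n] simp del: cycle_graph_simps)
  \<comment> \<open>Inside one piece every step changes sides.\<close>
  have "\<exists>t. fst (h t) \<noteq> fst (h (Suc t))"
  proof (rule ccontr)
    assume "\<not> ?thesis"
    then have same: "fst (h t) = fst (h (Suc t))" for t by blast
    have flip: "fst (snd (h (Suc t))) \<longleftrightarrow> \<not> fst (snd (h t))" for t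
      using h_step[of t] same[of t] cycle_graph_irrefl[of ?r] l
      by (cases "h t"; cases "h (Suc t)") (auto simp: BC_simps[OF n] simp del: cycle_graph_simps)
    have "fst (snd (h t)) \<longleftrightarrow> (even t \<longleftrightarrow> fst (snd (h 0)))" for t
      by (induction t) (auto simp: flip)
    from this[of L] show False using L h_period[of 0] by auto
  qed
  then obtain t0 where t0: "fst (h t0) \<noteq> fst (h (Suc t0))" by blast
  have next_crossing: "fst (h (Suc t)) \<noteq> fst (h (Suc (Suc t)))" if cr: "fst (h t) \<noteq> fst (h (Suc t))" for t
  proof
    assume eq: "fst (h (Suc t)) = fst (h (Suc (Suc t)))"
    \<comment> \<open>The first time after \<open>Suc t\<close> at which the walk leaves the piece entered at \<open>Suc t\<close>.\<close>
    define leaves where "leaves s \<longleftrightarrow> 1 \<le> s \<and> fst (h (Suc t + s)) \<noteq> fst (h (Suc t))" for s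
    define s where "s = (LEAST s. leaves s)"
    have "L \<noteq> 1" using cr h_period[of t] by auto
    then have "leaves (L - 1)" using cr h_period[of t] L0 by (auto simp: leaves_def add.commute)
    then have s: "leaves s" "s \<le> L - 1" unfolding s_def by (auto intro: LeastI Least_le)
    have s2: "2 \<le> s"
    proof (rule ccontr)
      assume "\<not> 2 \<le> s"
      then have "s = 1" using s by (auto simp: leaves_def)
      then show False using s eq by (simp add: leaves_def)
    qed
    have "\<not> leaves (s - 1)" using not_less_Least[of "s - 1" leaves] s2 by (simp add: s_def)
    then have same: "fst (h (t + s)) = fst (h (Suc t))" using s2 by (simp add: leaves_def)
    then have "fst (h (t + s)) \<noteq> fst (h (Suc (t + s)))" using s(1) by (simp add: leaves_def)
    from crossing[OF this] crossing[OF cr] same have "h (t + s) = h (Suc t)" by auto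
    then have "((s - 1) + Suc t) mod L = (0 + Suc t) mod L" using h_inj[of "t + s" "Suc t"] s2 by (simp add: add.commute)
    then have "(s - 1) mod L = 0 mod L" by (simp only: mod_add_right_cancel_nat)
    then show False using s s2 L0 by simp
  qed
  have all_cr: "fst (h (t0 + t)) \<noteq> fst (h (Suc (t0 + t)))" for t
    by (induction t) (use t0 next_crossing in auto)
  \<comment> \<open>All steps cross, so the first coordinates form a closed walk in the cycle on \<open>2 * l + 1\<close> vertices, without repetition.\<close>
  have "?r \<le> L"
  proof (rule odd_closed_walk_cycle_graph[where f = "\<lambda>t. fst (h (t0 + t))"])
    show "(fst (h (t0 + t)), fst (h (t0 + Suc t))) \<in> parcs (cycle_graph ?r)" for t
      using crossing[OF all_cr, of t] by auto
    show "fst (h (t0 + L)) = fst (h (t0 + 0))" using h_period[of t0] by simp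
  qed (use L in auto)
  moreover have "L \<le> ?r"
  proof -
    have inj': "inj_on (\<lambda>t. fst (h (t0 + t))) {..<L}"
    proof (rule inj_onI)
      fix s t assume st: "s \<in> {..<L}" "t \<in> {..<L}" "fst (h (t0 + s)) = fst (h (t0 + t))"
      then have "h (t0 + s) = h (t0 + t)" using crossing[OF all_cr, of s] crossing[OF all_cr, of t] by auto
      then have "(s + t0) mod L = (t + t0) mod L" using h_inj[of "t0 + s" "t0 + t"] by (simp add: add.commute)
      then have "s mod L = t mod L" by (simp only: mod_add_right_cancel_nat)
      then show "s = t" using st by simp
    qed
    have "(\<lambda>t. fst (h (t0 + t))) ` {..<L} \<subseteq> {..<?r}"
    proof
      fix i assume "i \<in> (\<lambda>t. fst (h (t0 + t))) ` {..<L}"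
      then obtain t where "i = fst (h (t0 + t))" by blast
      then show "i \<in> {..<?r}" using crossing[OF all_cr, of t] by auto
    qed
    then show ?thesis using card_inj_on_le[OF inj', of "{..<?r}"] by simp
  qed
  ultimately show ?thesis by simp
qed

lemma (in odd_cycle_family) BC_free_nonbipartite:
  assumes m: "0 < m" and n: "n = 2 * (2 * l + 1) * m"
  shows "free_nonbipartite \<C> n (real m) (BC l n)"
proof -
  let ?r = "2 * l + 1"
  have "\<not> contains_copy (BC l n) F" if F: "F \<in> \<C>" for F
  proof
    assume "contains_copy (BC l n) F"
    moreover obtain i where i: "F = cycle_graph (2 * i + 1)" using F odd by (auto simp: odd_cycles_def)
    ultimately obtain f where "inj_on f {..<2 * i + 1}"
      "\<And>j. j < 2 * i + 1 \<Longrightarrow> (f j, f (Suc j mod (2 * i + 1))) \<in> parcs (BC l n)"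
      using contains_copy_cycleD by metis
    then have "2 * i + 1 = ?r" using odd_cycle_in_BC[OF l_pos n, of "2 * i + 1" f] by simp
    then show False using l_notin F i by simp
  qed
  then have free: "family_free \<C> (BC l n)" by (simp add: family_free_def)
  have nonbip: "\<not> bipartite (BC l n)"
  proof (rule not_bipartite_if_odd_closed_walk)
    show "((j mod ?r, False, 0), (Suc j mod ?r, False, 0)) \<in> parcs (BC l n)" for j
      by (simp add: BC_simps[OF n] mod_Suc_eq del: mod_Suc)
    show "(?r mod ?r, False, 0) = (0 mod ?r, False, 0)" by simp
    show "odd ?r" by simp
  qed
  have fin: "finite (pverts (BC l n))" by (simp add: BC_simps[OF n])
  have side: "{i} \<times> {\<not> s} \<times> {..<m} \<subseteq> {y. ((i, s, a), y) \<in> parcs (BC l n)}" if "i < ?r" "a < m" for i s a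
    using that by (auto simp: BC_simps[OF n])
  have fin_nbs: "finite {y. (x, y) \<in> parcs (BC l n)}" for x
  proof (rule finite_subset[OF _ fin])
    show "{y. (x, y) \<in> parcs (BC l n)} \<subseteq> pverts (BC l n)"
      using m by (cases x) (auto simp: BC_simps[OF n])
  qed
  have "min_degree (BC l n) = m"
  proof (rule min_degree_eqI[OF fin])
    fix x assume "x \<in> pverts (BC l n)"
    then obtain i s a where x: "x = (i, s, a)" "i < ?r" "a < m" by (auto simp: BC_simps[OF n])
    show "m \<le> card {y. (x, y) \<in> parcs (BC l n)}"
      using card_mono[OF fin_nbs side[OF x(2,3)], of s] x(1) by (simp add: card_cartesian_product)
  next
    show "(0, True, 0) \<in> pverts (BC l n)" using m by (simp add: BC_simps[OF n])
    have "{y. ((0, True, 0), y) \<in> parcs (BC l n)} = {0} \<times> {False} \<times> {..<m}"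
      using m by (auto simp: BC_simps[OF n])
    then show "card {y. ((0, True, 0), y) \<in> parcs (BC l n)} = m" by (simp add: card_cartesian_product)
  qed
  moreover have "card (pverts (BC l n)) = n"
    unfolding BC_simps(1)[OF n] card_cartesian_product by (simp add: n)
  ultimately show ?thesis
    unfolding free_nonbipartite_def using free nonbip pair_graph_BC[OF l_pos m n] by simp
qed

section \<open>Uniqueness of the extremal graphs\<close>

lemma (in extremal_long_girth) iso_cycle_blow_up:
  assumes G: "pair_graph G" "pverts G = V" "parcs G = E" and t: "2 * t = d"
  shows "digraph_iso (with_proj G) (with_proj (blow_up (cycle_graph g) t))"
proof -
  interpret G: pair_graph G by fact
  have "\<exists>h. bij_betw h {..<t} (W i)" for i
    using ex_bij_betw_nat_finite[of "W i"] finV W_size[of i] t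
    by (auto simp: W_def atLeast0LessThan)
  then obtain h where h: "\<And>i. bij_betw (h i) {..<t} (W i)" by metis
  define \<phi> where "\<phi> = (\<lambda>(i, a). h i a)"
  have \<phi>: "\<phi> (i, a) \<in> W i" if "a < t" for i a
    using h[of i] that by (auto simp: \<phi>_def bij_betw_def)
  have "bij_betw \<phi> (pverts (blow_up (cycle_graph g) t)) (pverts G)"
    unfolding bij_betw_def
  proof
    show "inj_on \<phi> (pverts (blow_up (cycle_graph g) t))"
    proof (rule inj_onI)
      fix x y assume xy: "x \<in> pverts (blow_up (cycle_graph g) t)" "y \<in> pverts (blow_up (cycle_graph g) t)"
        "\<phi> x = \<phi> y"
      then obtain i a j b where ia: "x = (i, a)" "y = (j, b)" "i < g" "a < t" "j < g" "b < t" by auto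
      then have "i = j" using \<phi>[of a i] \<phi>[of b j] W_disjoint[of i j] xy(3) by auto
      then show "x = y" using ia xy(3) h[of i] by (auto simp: \<phi>_def bij_betw_def inj_on_def)
    qed
    show "\<phi> ` pverts (blow_up (cycle_graph g) t) = pverts G"
    proof
      show "\<phi> ` pverts (blow_up (cycle_graph g) t) \<subseteq> pverts G"
      proof
        fix v assume "v \<in> \<phi> ` pverts (blow_up (cycle_graph g) t)"
        then obtain i a where "v = \<phi> (i, a)" "a < t" by auto
        then show "v \<in> pverts G" using \<phi>[of a i] G(2) by (auto simp: W_def)
      qed
      show "pverts G \<subseteq> \<phi> ` pverts (blow_up (cycle_graph g) t)"
      proof
        fix v assume "v \<in> pverts G"
        then obtain i where i: "i < g" "v \<in> W i" using W_cover G(2) by blast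
        then have "v \<in> h i ` {..<t}" using h[of i] by (simp add: bij_betw_def)
        then obtain a where "a < t" "h i a = v" by blast
        then show "v \<in> \<phi> ` pverts (blow_up (cycle_graph g) t)"
          using i by (intro image_eqI[of _ _ "(i, a)"]) (auto simp: \<phi>_def)
      qed
    qed
  qed
  moreover have "(\<phi> x, \<phi> y) \<in> parcs G \<longleftrightarrow> (x, y) \<in> parcs (blow_up (cycle_graph g) t)"
    if "x \<in> pverts (blow_up (cycle_graph g) t)" "y \<in> pverts (blow_up (cycle_graph g) t)" for x y
    using that W_edge_iff[OF _ _ \<phi> \<phi>] G(3) by auto
  moreover have "pair_wf_digraph (blow_up (cycle_graph g) t)"
    using pair_graph_blow_up_cycle[of g t] g_ge7 by (simp add: pair_graph_def pair_digraph_def pair_fin_digraph_def)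
  moreover have "pair_wf_digraph G" by unfold_locales
  ultimately show ?thesis by (intro digraph_iso_by_inverse)
qed

lemma (in extremal_short_odd_girth) iso_BC:
  assumes G: "pair_graph G" "pverts G = V" "parcs G = E"
    and l: "1 \<le> l" "g = 2 * l + 1" and n: "n = 2 * (2 * l + 1) * d"
  shows "digraph_iso (with_proj G) (with_proj (BC l n))"
proof -
  interpret G: pair_graph G by fact
  have d0: "0 < d" using d_gt_g by simp
  \<comment> \<open>The number 0 must go to the selected vertex.\<close>
  have "\<exists>h. bij_betw h {..<d} (P i) \<and> h 0 = c i" if i: "i < g" for i
  proof -
    have "card {1..<d} = card (P i - {c i})"
      using card_PQ_eq(1)[OF i] c_in_P[OF i] finite_PQ by simp
    then obtain h where h: "bij_betw h {1..<d} (P i - {c i})"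
      using finite_same_card_bij[of "{1..<d}" "P i - {c i}"] finite_PQ by auto
    then have "bij_betw (h(0 := c i)) {1..<d} (P i - {c i})"
      by (subst bij_betw_cong[of _ _ h]) auto
    then have "bij_betw (h(0 := c i)) ({1..<d} \<union> {0}) (P i - {c i} \<union> {c i})"
      using notIn_Un_bij_betw[of 0 "{1..<d}" "h(0 := c i)" "P i - {c i}"] by simp
    moreover have "{1..<d} \<union> {0} = {..<d}" using d0 by auto
    moreover have "P i - {c i} \<union> {c i} = P i" using c_in_P[OF i] by auto
    ultimately show ?thesis by (intro exI[of _ "h(0 := c i)"]) auto
  qed
  then obtain hP where hP: "\<And>i. i < g \<Longrightarrow> bij_betw (hP i) {..<d} (P i)" "\<And>i. i < g \<Longrightarrow> hP i 0 = c i"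
    by metis
  have "\<exists>h. bij_betw h {..<d} (Q i)" if "i < g" for i
    using ex_bij_betw_nat_finite[of "Q i"] finite_PQ card_PQ_eq(2)[OF that] by (auto simp: atLeast0LessThan)
  then obtain hQ where hQ: "\<And>i. i < g \<Longrightarrow> bij_betw (hQ i) {..<d} (Q i)" by metis
  define S where "S i s = (if s then Q i else P i)" for i s
  define \<phi> where "\<phi> = (\<lambda>(i, s, a). if s then hQ i a else hP i a)"
  have bij: "bij_betw (\<lambda>a. \<phi> (i, s, a)) {..<d} (S i s)" if "i < g" for i s
    using hP(1)[OF that] hQ[OF that] by (simp add: \<phi>_def S_def)
  have \<phi>: "\<phi> (i, s, a) \<in> S i s" if "i < g" "a < d" for i s a
    using bij[OF that(1), of s] that(2) by (auto simp: bij_betw_def)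
  have \<phi>_c: "\<phi> (i, False, a) = c i \<longleftrightarrow> a = 0" if "i < g" "a < d" for i a
    using bij[OF that(1), of False] hP(2)[OF that(1)] that(2) d0
    by (auto simp: bij_betw_def inj_on_def \<phi>_def)
  have S_disj: "i = j \<and> s = t" if "i < g" "j < g" "v \<in> S i s" "v \<in> S j t" for i j s t v
    using that P_disjoint[of i j] Q_disjoint[of i j] P_Q_disjoint[of i j] P_Q_disjoint[of j i]
    by (cases s; cases t) (auto simp: S_def)
  have verts: "pverts (BC l n) = {..<g} \<times> UNIV \<times> {..<d}" using BC_simps(1)[OF n] l by simp
  have "bij_betw \<phi> (pverts (BC l n)) (pverts G)"
    unfolding bij_betw_def
  proof
    show "inj_on \<phi> (pverts (BC l n))"
    proof (rule inj_onI)
      fix x y assume xy: "x \<in> pverts (BC l n)" "y \<in> pverts (BC l n)" "\<phi> x = \<phi> y"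
      then obtain i s a j t b where x: "x = (i, s, a)" "i < g" "a < d" and y: "y = (j, t, b)" "j < g" "b < d"
        by (auto simp: verts)
      then have "i = j \<and> s = t" using S_disj[OF x(2) y(2) \<phi>[OF x(2,3)]] \<phi>[OF y(2,3)] xy(3) by metis
      then show "x = y" using x y xy(3) bij[OF x(2), of s] by (auto simp: bij_betw_def inj_on_def)
    qed
    show "\<phi> ` pverts (BC l n) = pverts G"
    proof
      show "\<phi> ` pverts (BC l n) \<subseteq> pverts G"
      proof
        fix v assume "v \<in> \<phi> ` pverts (BC l n)"
        then obtain i s a where "v = \<phi> (i, s, a)" "i < g" "a < d" by (auto simp: verts)
        then have "v \<in> S i s" "i < g" using \<phi> by auto
        then show "v \<in> pverts G" unfolding G(2) by (auto simp: S_def P_def Q_def split: if_splits)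
      qed
      show "pverts G \<subseteq> \<phi> ` pverts (BC l n)"
      proof
        fix v assume "v \<in> pverts G"
        then have "v \<in> V" using G(2) by simp
        then have "\<exists>i s. i < g \<and> v \<in> S i s"
        proof (cases rule: exhaust_pieces)
          case (1 i)
          then have "v \<in> S i False" by (simp add: S_def)
          then show ?thesis using 1 by blast
        next
          case (2 i)
          then have "v \<in> S i True" by (simp add: S_def)
          then show ?thesis using 2 by blast
        qed
        then obtain i s where i: "i < g" "v \<in> S i s" by blast
        then have "v \<in> (\<lambda>a. \<phi> (i, s, a)) ` {..<d}" using bij[OF i(1), of s] by (simp add: bij_betw_def)
        then obtain a where "a < d" "\<phi> (i, s, a) = v" by blast
        then show "v \<in> \<phi> ` pverts (BC l n)" using i by (intro image_eqI[of _ _ "(i, s, a)"]) (auto simp: verts)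
      qed
    qed
  qed
  moreover have "(\<phi> x, \<phi> y) \<in> parcs G \<longleftrightarrow> (x, y) \<in> parcs (BC l n)"
    if xy: "x \<in> pverts (BC l n)" "y \<in> pverts (BC l n)" for x y
  proof -
    obtain i s a j t b where x: "x = (i, s, a)" "i < g" "a < d" and y: "y = (j, t, b)" "j < g" "b < d"
      using xy by (auto simp: verts)
    have inP: "\<phi> x \<in> P j \<longleftrightarrow> \<not> s \<and> i = j" if "j < g" for j
      using S_disj[OF x(2) that \<phi>[OF x(2,3)], of s False] \<phi>[OF x(2,3), of s] x(1) by (auto simp: S_def)
    have inP': "\<phi> y \<in> P j' \<longleftrightarrow> \<not> t \<and> j = j'" if "j' < g" for j'
      using S_disj[OF y(2) that \<phi>[OF y(2,3)], of t False] \<phi>[OF y(2,3), of t] y(1) by (auto simp: S_def)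
    have rhs: "(x, y) \<in> parcs (BC l n) \<longleftrightarrow> i = j \<and> s \<noteq> t \<or>
        \<not> s \<and> \<not> t \<and> a = 0 \<and> b = 0 \<and> (j = Suc i mod g \<or> i = Suc j mod g)"
      using x y BC_simps(2)[OF n, of i s a j t b] l(2) by simp
    show ?thesis
    proof (cases s)
      case True
      then have "\<phi> x \<in> Q i" using \<phi>[OF x(2,3), of s] x(1) by (simp add: S_def)
      from edge_Q_iff[OF x(2) this] show ?thesis using inP'[OF x(2)] rhs True G(3) by auto
    next
      case False
      show ?thesis
      proof (cases t)
        case True
        then have "\<phi> y \<in> Q j" using \<phi>[OF y(2,3), of t] y(1) by (simp add: S_def)
        from edge_Q_iff[OF y(2) this, of "\<phi> x"] have "(\<phi> y, \<phi> x) \<in> E \<longleftrightarrow> i = j"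
          using inP[OF y(2)] False by auto
        then show ?thesis using rhs False True G(3) E_sym by blast
      next
        case t: False
        have "\<phi> x \<in> P i" "\<phi> y \<in> P j" using inP[OF x(2)] inP'[OF y(2)] False t by auto
        from edge_P_P_iff[OF x(2) y(2) this] show ?thesis
          using rhs False t G(3) \<phi>_c[OF x(2,3)] \<phi>_c[OF y(2,3)] x(1) y(1) by auto
      qed
    qed
  qed
  moreover have "pair_wf_digraph (BC l n)"
    using pair_graph_BC[OF l(1) d0 n] by (simp add: pair_graph_def pair_digraph_def pair_fin_digraph_def)
  moreover have "pair_wf_digraph G" by unfold_locales
  ultimately show ?thesis by (intro digraph_iso_by_inverse)
qed

context odd_cycle_family
begin

lemma odd_cycle_notin_C_free:
  assumes "pair_graph G" "family_free \<C> G" "cycle_graph m \<in> \<C>"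
  shows "\<not> sgraph.cyc (parcs G) m"
  using sgraph.cyc_imp_copy[OF pair_graph_imp_sgraph, of G G m] assms by (auto simp: family_free_def)

text \<open>The odd girth $g$ decides which graph arises. It is at least $2\ell+1$ because all shorter odd
  cycles are forbidden, and it is not $2k+1$.\<close>

lemma extremal_structure:
  fixes G :: "'a pair_pre_digraph"
  assumes G: "pair_graph G" "card (pverts G) = n" "family_free \<C> G" "\<not> bipartite G"
    and n: "1000 * k ^ 5 \<le> n"
    and d1: "n \<le> 2 * (2 * l + 1) * min_degree G"
    and d2: "2 * n \<le> (2 * k + 3) * min_degree G"
  shows "n = 2 * (2 * l + 1) * min_degree G \<and> digraph_iso (with_proj G) (with_proj (BC l n)) \<or>
    (\<exists>t. min_degree G = 2 * t \<and> n = (2 * k + 3) * t \<and>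
      digraph_iso (with_proj G) (with_proj (cycle_blow_up k n)))"
proof -
  define V where "V = pverts G"
  define E where "E = parcs G"
  define d where "d = min_degree G"
  have VE: "pverts G = V" "parcs G = E" "card V = n" by (auto simp: V_def E_def G(2))
  interpret sgraph V E unfolding V_def E_def by (rule pair_graph_imp_sgraph[OF G(1)])
  have deg: "d \<le> card (nb v)" if "v \<in> V" for v
    using that finV unfolding d_def min_degree_def out_degree_eq nb_def VE by (intro Min_le) auto
  have k5: "0 < n" using n l_less_k by (cases "n = 0") auto
  obtain L x where "odd L" "(x, x) \<in> E ^^ L"
    using bipartition_if_no_odd_closed_walk G(4) unfolding bipartite_def VE by blast
  then obtain c g where "shortest_odd_walk V E c g" by (rule shortest_odd_walk_exists)
  then interpret shortest_odd_walk V E c g .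
  obtain m where m: "g = 2 * m + 1" using odd_g by (auto elim: oddE)
  have m1: "1 \<le> m" using m g_ge3 by simp
  have no_cyc: "\<not> cyc (2 * i + 1)" if "cycle_graph (2 * i + 1) \<in> \<C>" for i
    using odd_cycle_notin_C_free[OF G(1,3) that] by (simp add: E_def)
  have l_le: "l \<le> m" using less_l_in[OF m1] no_cyc[of m] cyc_g m by force
  have "m \<noteq> k" using no_cyc[OF k_in] cyc_g m by auto
  then consider "m < k" | "k < m" by linarith
  then show ?thesis
  proof cases
    case 1
    interpret dense_short_odd_girth V E c g k m d
      by unfold_locales (use m 1 no_cyc[OF k_in] deg d2 n VE in \<open>auto simp: d_def\<close>)
    have "2 * (2 * l + 1) * d \<le> 2 * g * d" using l_le m by (intro mult_right_mono) auto
    then interpret extremal_short_odd_girth V E c g k m d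
      by unfold_locales (use d1 VE in \<open>auto simp: d_def\<close>)
    have "2 * g * d \<le> 2 * (2 * l + 1) * d" using card_V_eq d1 VE by (simp add: d_def)
    then have "g * (2 * d) \<le> (2 * l + 1) * (2 * d)" by (simp only: ac_simps)
    then have "g \<le> 2 * l + 1" using d_gt_g by (simp only: mult_le_cancel2)
    then have g: "g = 2 * l + 1" using l_le m by simp
    then have n_eq: "n = 2 * (2 * l + 1) * d" using card_V_eq VE by simp
    from iso_BC[OF G(1) VE(1,2) l_pos g n_eq] show ?thesis using n_eq by (simp add: d_def)
  next
    case 2
    then have g: "2 * k + 3 \<le> g" using m by simp
    interpret long_odd_girth V E c g
      by unfold_locales (use g l_pos l_less_k in auto)
    have d0: "0 < d" using d2 k5 by (cases "d = 0") (auto simp: d_def)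
    have up: "g * d \<le> 2 * n" using girth_degree_bound[OF deg] VE by simp
    have "g * d \<le> (2 * k + 3) * d" using up d2 unfolding d_def by linarith
    then have g_eq: "g = 2 * k + 3" using g d0 by simp
    have "2 * n \<le> g * d" using d2 unfolding g_eq d_def .
    then have tight: "g * d = 2 * card V" using up VE(3) by simp
    interpret extremal_long_girth V E c g d
      by unfold_locales (use deg tight in auto)
    define t where "t = card (W 0)"
    have t: "2 * t = d" using W_size[of 0] by (simp add: t_def)
    have n_eq: "n = (2 * k + 3) * t" using tight t g_eq VE by auto
    have "cycle_blow_up k n = blow_up (cycle_graph g) t"
      unfolding cycle_blow_up_def g_eq n_eq by simp
    then show ?thesis using iso_cycle_blow_up[OF G(1) VE(1,2) t] t n_eq by (auto simp: d_def)
  qed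
qed

end

theorem theorem1p5:
  fixes l k n :: nat and \<C> :: "nat pair_pre_digraph set"
  assumes "1 \<le> l" and "l < k" and "n \<ge> 1000 * k ^ 8"
    and "\<C> \<subseteq> odd_cycles"
    and "cycle_graph (2 * l + 1) \<notin> \<C>"
    and "\<And>i. 1 \<le> i \<Longrightarrow> i < l \<Longrightarrow> cycle_graph (2 * i + 1) \<in> \<C>"
    and "cycle_graph (2 * k + 1) \<in> \<C>"
    and "\<And>i. k < i \<Longrightarrow> cycle_graph (2 * i + 1) \<notin> \<C>"
  defines "d1 \<equiv> real n / real (2 * (2 * l + 1))"
    and "d2 \<equiv> 2 * real n / real (2 * k + 3)"
  shows "(\<forall>G :: 'a pair_pre_digraph.
            pair_graph G \<and> card (pverts G) = n \<and> family_free \<C> G \<and>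
            real (min_degree G) > max d1 d2 \<longrightarrow> bipartite G) \<and>
         (max d1 d2 = d1 \<longrightarrow>
            (2 * (2 * l + 1) dvd n \<longrightarrow> free_nonbipartite \<C> n d1 (BC l n)) \<and>
            (\<forall>G :: 'a pair_pre_digraph. free_nonbipartite \<C> n d1 G \<longrightarrow>
               2 * (2 * l + 1) dvd n \<and> digraph_iso (with_proj G) (with_proj (BC l n)))) \<and>
         (max d1 d2 = d2 \<longrightarrow>
            (2 * k + 3 dvd n \<longrightarrow> free_nonbipartite \<C> n d2 (cycle_blow_up k n)) \<and>
            (\<forall>G :: 'a pair_pre_digraph. free_nonbipartite \<C> n d2 G \<longrightarrow>
               2 * k + 3 dvd n \<and> digraph_iso (with_proj G) (with_proj (cycle_blow_up k n))))"
proof -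
  interpret odd_cycle_family l k \<C>
    using assms by unfold_locales auto
  have k2: "2 \<le> k" using assms(1,2) by simp
  have "k ^ 5 \<le> k ^ 8" using k2 by (intro power_increasing) auto
  then have n5: "1000 * k ^ 5 \<le> n" using assms(3) by linarith
  have n0: "0 < n" using assms(3) k2 by (cases "n = 0") auto
  have d1_times: "2 * (2 * real l + 1) * d1 = real n" and d2_times: "(2 * real k + 3) * d2 = 2 * real n"
    by (simp_all add: d1_def d2_def field_simps)
  have d1_le: "n \<le> 2 * (2 * l + 1) * d" if "d1 \<le> real d" for d
  proof -
    have "2 * (2 * real l + 1) * d1 \<le> 2 * (2 * real l + 1) * real d"
      using that by (intro mult_left_mono) auto
    also have "\<dots> = real (2 * (2 * l + 1) * d)" by (simp add: algebra_simps)
    finally have "real n \<le> real (2 * (2 * l + 1) * d)" unfolding d1_times .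
    then show ?thesis by (simp only: of_nat_le_iff)
  qed
  have d2_le: "2 * n \<le> (2 * k + 3) * d" if "d2 \<le> real d" for d
  proof -
    have "(2 * real k + 3) * d2 \<le> (2 * real k + 3) * real d"
      using that by (intro mult_left_mono) auto
    also have "\<dots> = real ((2 * k + 3) * d)" by simp
    finally have "real (2 * n) \<le> real ((2 * k + 3) * d)" unfolding d2_times by simp
    then show ?thesis by (simp only: of_nat_le_iff)
  qed
  \<comment> \<open>The thresholds never coincide: \<open>4 (2 l + 1)\<close> is even and \<open>2 k + 3\<close> is odd.\<close>
  have ne: "d1 \<noteq> d2"
  proof
    assume "d1 = d2"
    then have "(2 * real k + 3) * real n = 4 * (2 * real l + 1) * real n"
      using d1_times d2_times by (metis mult.assoc mult.left_commute mult_2 numeral_Bit0)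
    then have "2 * real k + 3 = 4 * (2 * real l + 1)" using n0 by simp
    then have "real (2 * k + 3) = real (4 * (2 * l + 1))" by simp
    then have "2 * k + 3 = 4 * (2 * l + 1)" by (simp only: of_nat_eq_iff)
    then show False by presburger
  qed
  have struct: "real (min_degree G) = d1 \<and> 2 * (2 * l + 1) dvd n \<and> digraph_iso (with_proj G) (with_proj (BC l n)) \<or>
      real (min_degree G) = d2 \<and> 2 * k + 3 dvd n \<and> digraph_iso (with_proj G) (with_proj (cycle_blow_up k n))"
    if G: "pair_graph G" "card (pverts G) = n" "family_free \<C> G" "\<not> bipartite G"
      "max d1 d2 \<le> real (min_degree G)" for G :: "'a pair_pre_digraph"
  proof -
    have "n \<le> 2 * (2 * l + 1) * min_degree G" "2 * n \<le> (2 * k + 3) * min_degree G"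
      using d1_le d2_le G(5) by simp_all
    from extremal_structure[OF G(1-4) n5 this] show ?thesis
    proof (elim disjE exE conjE)
      assume "n = 2 * (2 * l + 1) * min_degree G" "digraph_iso (with_proj G) (with_proj (BC l n))"
      moreover from this have "real (min_degree G) = d1" unfolding d1_def by (simp add: field_simps)
      ultimately show ?thesis by (metis dvd_triv_left)
    next
      fix t assume "min_degree G = 2 * t" "n = (2 * k + 3) * t"
        "digraph_iso (with_proj G) (with_proj (cycle_blow_up k n))"
      moreover from this have "real (min_degree G) = d2" unfolding d2_def by (simp add: field_simps)
      ultimately show ?thesis by (metis dvd_triv_left)
    qed
  qed
  have BC: "free_nonbipartite \<C> n d1 (BC l n)" if "2 * (2 * l + 1) dvd n"
  proof -
    obtain m where m: "n = 2 * (2 * l + 1) * m" using \<open>2 * (2 * l + 1) dvd n\<close> by (rule dvdE)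
    then have "0 < m" "real m = d1" using n0 unfolding d1_def by (auto simp: field_simps)
    then show ?thesis using BC_free_nonbipartite[OF _ m] by simp
  qed
  have CB: "free_nonbipartite \<C> n d2 (cycle_blow_up k n)" if "2 * k + 3 dvd n"
  proof -
    obtain t where t: "n = (2 * k + 3) * t" using \<open>2 * k + 3 dvd n\<close> by (rule dvdE)
    then have "0 < t" "real (2 * t) = d2" using n0 unfolding d2_def by (auto simp: field_simps)
    then show ?thesis using blow_up_free_nonbipartite[OF _ t] by simp
  qed
  show ?thesis
  proof (intro conjI impI allI)
    fix G :: "'a pair_pre_digraph"
    assume G: "pair_graph G \<and> card (pverts G) = n \<and> family_free \<C> G \<and> real (min_degree G) > max d1 d2"
    show "bipartite G"
    proof (rule ccontr)
      assume "\<not> bipartite G"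
      then show False using struct[of G] G by auto
    qed
  next
    fix G :: "'a pair_pre_digraph"
    assume "max d1 d2 = d1" and G: "free_nonbipartite \<C> n d1 G"
    then have "2 * (2 * l + 1) dvd n \<and> digraph_iso (with_proj G) (with_proj (BC l n))"
      using struct[of G] ne unfolding free_nonbipartite_def by auto
    then show "2 * (2 * l + 1) dvd n" "digraph_iso (with_proj G) (with_proj (BC l n))" by simp_all
  next
    fix G :: "'a pair_pre_digraph"
    assume "max d1 d2 = d2" and G: "free_nonbipartite \<C> n d2 G"
    then have "2 * k + 3 dvd n \<and> digraph_iso (with_proj G) (with_proj (cycle_blow_up k n))"
      using struct[of G] ne unfolding free_nonbipartite_def by auto
    then show "2 * k + 3 dvd n" "digraph_iso (with_proj G) (with_proj (cycle_blow_up k n))" by simp_all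
  qed (use BC CB in auto)
qed

end
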